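(* Let $G=(V,w,\mu,d)$ be a finite connected weighted graph with general path distance $d$ satisfying $\sum_{y}w(x,y)=\mu(x)$ for every $x\in V$. The following are equivalent: (i) $G$ is Ollivier-Betti sharp and bone-idle; (ii) $G$ is Ollivier-Betti sharp and $\kappa_1(x,y)\ge0$ for every edge $x\sim y$; (iii) there exist an abelian group structure $\cdot$ on $V$ and $a_1,\dots,a_m\in V$ such that $((V,\cdot),(a_1,\dots,a_m),w,\mu,d)$ is a weighted flat torus, $\mu$ is constant, and $d(x,a_i x)=d(x',a_i x')$ for all $x,x'\in V$ and $i\in\{1,\dots,m\}$.
   Context: Graph setting: $V$ finite, $w$ symmetric nonnegative vanishing on the diagonal, $\mu>0$, $x\sim y$ iff $w(x,y)>0$, $G$ connected; $d$ a general path distance (symmetric, $d(x,y)=0$ iff $x=y$, and $d(x,y)$ equals the infimum of $\sum d(x_{k-1},x_k)$ over paths $x=x_0\sim\dots\sim x_n=y$). $p(x,y)=w(x,y)/\mu(x)$, $\deg(x)=|\{y:y\sim x\}|$, $\deg_{\max}=\max\deg$. Laplacian $\Delta f(x)=\sum_y p(x,y)(f(y)-f(x))$; $\nabla_{xy}f=(f(x)-f(y))/d(x,y)$; Ollivier curvature $\kappa(x,y)=\inf\{\nabla_{xy}\Delta f:\nabla_{yx}f=1,\sup_{u\ne v}|\nabla_{uv}f|=1\}$; non-negative Ollivier curvature means $\kappa\ge0$ on all edges. For $\varepsilon\in[0,1]$ let $m_x^\varepsilon(x)=1-\varepsilon$ and $m_x^\varepsilon(y)=\varepsilon p(x,y)$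 for $y\ne x$; $W$ is the $1$-Wasserstein distance with respect to $d$ (infimum of $\sum\rho(x,y)d(x,y)$ over couplings $\rho$); $\kappa_\varepsilon(x,y)=1-W(m_x^\varepsilon,m_y^\varepsilon)/d(x,y)$. $G$ is bone-idle if $\sum_y w(x,y)=\mu(x)$ for all $x$ and $\kappa_\varepsilon(x,y)=0$ for all $\varepsilon\in[0,1]$ and all edges $x\sim y$. $M_2(G)$: 1-forms are antisymmetric functions on ordered adjacent pairs; a cycle is $(x_0\sim\dots\sim x_{n-1})$, distinct vertices, $n\ge3$, $x_{n-1}\sim x_0$, up to rotation and reversal; $X_2$ = cycles admitting a labeling with $n=3$, or with $d(x_0,x_3)<d(x_0,x_1)+d(x_1,x_2)+d(x_2,x_3)$ and $x_3\sim\dots\sim x_{n-1}\sim x_0$ a geodesic; $\delta\alpha(c)=\sum_i\alpha(x_i,x_{i+1\bmod n})$, $\delta^*\alpha(x)=\sum_y p(x,y)\alpha(x,y)$; $H_1(M_2(G))=\{\alpha:\delta\alpha=0\text{ on }X_2,\delta^*\alpha\equiv0\}$; $\beta_1=\dim H_1$. Ollivier-Betti sharp: non-negative Ollivier curvature and $\beta_1(M_2(G))=\deg_{\max}/2$. Weighted flat torus $((V,\cdot),(a_1,\dots,a_m),w,\mu,d)$: $(V,\cdot)$ abelian group generated by $a_1,\dots,a_m$ with $a_i\ne a_j^{\pm1}$ for $i\ne j$, and (i) $w(x,y)>0$ iff $y\in\{a_i^{\pm1}x\}$; (ii) $w(x,a_ix)d(x,a_ix)=w(x,a_i^{-1}x)d(x,a_i^{-1}x)$;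 (iii) $p(x,a_i^{\varepsilon_1}x)=p(a_j^{\varepsilon_2}x,a_i^{\varepsilon_1}a_j^{\varepsilon_2}x)$ for $i\ne j$, $\varepsilon_1,\varepsilon_2=\pm1$; (iv) $d(x,a_ix)=d(a_jx,a_ia_jx)$ for $i\ne j$; (v) $\beta_1(M_2(G))=m$. *)

theory Defs
  imports "HOL-Analysis.Analysis" "HOL-Algebra.Generated_Groups"
begin

text \<open>
  A weighted graph is given by \<open>w\<close>, \<open>mu\<close> and \<open>d\<close>; its vertex set is the whole finite type \<open>'a\<close>.
\<close>

definition adj :: "('a \<Rightarrow> 'a \<Rightarrow> real) \<Rightarrow> 'a \<Rightarrow> 'a \<Rightarrow> bool" where
  "adj w x y \<longleftrightarrow> w x y > 0"

text \<open>A path \<open>x\<^sub>0 \<sim> \<dots> \<sim> x\<^sub>n\<close> is the nonempty list of its vertices; \<open>n = 0\<close> is allowed.\<close>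

definition graph_path :: "('a \<Rightarrow> 'a \<Rightarrow> real) \<Rightarrow> 'a list \<Rightarrow> bool" where
  "graph_path w xs \<longleftrightarrow> xs \<noteq> [] \<and> successively (adj w) xs"

definition path_length :: "('a \<Rightarrow> 'a \<Rightarrow> real) \<Rightarrow> 'a list \<Rightarrow> real" where
  "path_length d xs = (\<Sum>k = 1..<length xs. d (xs ! (k - 1)) (xs ! k))"

definition geodesic :: "('a \<Rightarrow> 'a \<Rightarrow> real) \<Rightarrow> ('a \<Rightarrow> 'a \<Rightarrow> real) \<Rightarrow> 'a list \<Rightarrow> bool" where
  "geodesic w d xs \<longleftrightarrow> graph_path w xs \<and> path_length d xs = d (hd xs) (last xs)"

definition weighted_graph :: "('a::finite \<Rightarrow> 'a \<Rightarrow> real) \<Rightarrow> ('a \<Rightarrow> real) \<Rightarrow> bool" where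
  "weighted_graph w mu \<longleftrightarrow>
     (\<forall>x y. w x y = w y x) \<and> (\<forall>x y. w x y \<ge> 0) \<and> (\<forall>x. w x x = 0) \<and> (\<forall>x. mu x > 0)"

definition connected_graph :: "('a \<Rightarrow> 'a \<Rightarrow> real) \<Rightarrow> bool" where
  "connected_graph w \<longleftrightarrow> (\<forall>x y. \<exists>xs. graph_path w xs \<and> hd xs = x \<and> last xs = y)"

definition path_distance :: "('a \<Rightarrow> 'a \<Rightarrow> real) \<Rightarrow> ('a \<Rightarrow> 'a \<Rightarrow> real) \<Rightarrow> bool" where
  "path_distance w d \<longleftrightarrow>
     (\<forall>x y. d x y \<ge> 0) \<and>
     (\<forall>x y. d x y = d y x) \<and>
     (\<forall>x y. d x y = 0 \<longleftrightarrow> x = y) \<and>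
     (\<forall>x y. d x y = Inf {path_length d xs | xs. graph_path w xs \<and> hd xs = x \<and> last xs = y})"

definition trans_prob :: "('a \<Rightarrow> 'a \<Rightarrow> real) \<Rightarrow> ('a \<Rightarrow> real) \<Rightarrow> 'a \<Rightarrow> 'a \<Rightarrow> real" where
  "trans_prob w mu x y = w x y / mu x"

definition degree_of :: "('a::finite \<Rightarrow> 'a \<Rightarrow> real) \<Rightarrow> 'a \<Rightarrow> nat" where
  "degree_of w x = card {y. adj w y x}"

definition max_degree :: "('a::finite \<Rightarrow> 'a \<Rightarrow> real) \<Rightarrow> nat" where
  "max_degree w = Max (range (degree_of w))"

definition laplacian ::
  "('a::finite \<Rightarrow> 'a \<Rightarrow> real) \<Rightarrow> ('a \<Rightarrow> real) \<Rightarrow> ('a \<Rightarrow> real) \<Rightarrow> 'a \<Rightarrow> real" where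
  "laplacian w mu f x = (\<Sum>y\<in>UNIV. trans_prob w mu x y * (f y - f x))"

definition grad :: "('a \<Rightarrow> 'a \<Rightarrow> real) \<Rightarrow> 'a \<Rightarrow> 'a \<Rightarrow> ('a \<Rightarrow> real) \<Rightarrow> real" where
  "grad d x y f = (f x - f y) / d x y"

definition ollivier_curvature ::
  "('a::finite \<Rightarrow> 'a \<Rightarrow> real) \<Rightarrow> ('a \<Rightarrow> real) \<Rightarrow> ('a \<Rightarrow> 'a \<Rightarrow> real) \<Rightarrow> 'a \<Rightarrow> 'a \<Rightarrow> real" where
  "ollivier_curvature w mu d x y =
     Inf {grad d x y (laplacian w mu f) | f.
            grad d y x f = 1 \<and> Sup {\<bar>grad d u v f\<bar> | u v. u \<noteq> v} = 1}"

definition nonneg_ollivier_curvature ::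
  "('a::finite \<Rightarrow> 'a \<Rightarrow> real) \<Rightarrow> ('a \<Rightarrow> real) \<Rightarrow> ('a \<Rightarrow> 'a \<Rightarrow> real) \<Rightarrow> bool" where
  "nonneg_ollivier_curvature w mu d \<longleftrightarrow>
     (\<forall>x y. adj w x y \<longrightarrow> ollivier_curvature w mu d x y \<ge> 0)"

definition lazy_walk ::
  "('a \<Rightarrow> 'a \<Rightarrow> real) \<Rightarrow> ('a \<Rightarrow> real) \<Rightarrow> real \<Rightarrow> 'a \<Rightarrow> 'a \<Rightarrow> real" where
  "lazy_walk w mu \<epsilon> x y = (if y = x then 1 - \<epsilon> else \<epsilon> * trans_prob w mu x y)"

definition coupling ::
  "('a::finite \<Rightarrow> real) \<Rightarrow> ('a \<Rightarrow> real) \<Rightarrow> ('a \<Rightarrow> 'a \<Rightarrow> real) \<Rightarrow> bool" where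
  "coupling m m' \<rho> \<longleftrightarrow>
     (\<forall>x y. \<rho> x y \<ge> 0) \<and>
     (\<forall>x. (\<Sum>y\<in>UNIV. \<rho> x y) = m x) \<and>
     (\<forall>y. (\<Sum>x\<in>UNIV. \<rho> x y) = m' y)"

definition wasserstein ::
  "('a::finite \<Rightarrow> 'a \<Rightarrow> real) \<Rightarrow> ('a \<Rightarrow> real) \<Rightarrow> ('a \<Rightarrow> real) \<Rightarrow> real" where
  "wasserstein d m m' =
     Inf {(\<Sum>x\<in>UNIV. \<Sum>y\<in>UNIV. \<rho> x y * d x y) | \<rho>. coupling m m' \<rho>}"

definition idle_curvature ::
  "('a::finite \<Rightarrow> 'a \<Rightarrow> real) \<Rightarrow> ('a \<Rightarrow> real) \<Rightarrow> ('a \<Rightarrow> 'a \<Rightarrow> real) \<Rightarrow> real \<Rightarrow> 'a \<Rightarrow> 'a \<Rightarrow> real"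
where
  "idle_curvature w mu d \<epsilon> x y =
     1 - wasserstein d (lazy_walk w mu \<epsilon> x) (lazy_walk w mu \<epsilon> y) / d x y"

definition bone_idle ::
  "('a::finite \<Rightarrow> 'a \<Rightarrow> real) \<Rightarrow> ('a \<Rightarrow> real) \<Rightarrow> ('a \<Rightarrow> 'a \<Rightarrow> real) \<Rightarrow> bool" where
  "bone_idle w mu d \<longleftrightarrow>
     (\<forall>x. (\<Sum>y\<in>UNIV. w x y) = mu x) \<and>
     (\<forall>\<epsilon>\<in>{0..1}. \<forall>x y. adj w x y \<longrightarrow> idle_curvature w mu d \<epsilon> x y = 0)"

text \<open>
  A 1-form is stored as a matrix vanishing off the adjacent pairs, so that the vector space
  structure and \<open>dim\<close> of the library apply.
\<close>

definition one_forms :: "('a::finite \<Rightarrow> 'a \<Rightarrow> real) \<Rightarrow> (real ^ 'a ^ 'a) set" where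
  "one_forms w =
     {\<alpha>. (\<forall>x y. \<not> adj w x y \<longrightarrow> \<alpha> $ x $ y = 0) \<and>
          (\<forall>x y. adj w x y \<longrightarrow> \<alpha> $ x $ y = - \<alpha> $ y $ x)}"

text \<open>
  A cycle is represented by all its labelings: a labeling is the list
  \<open>[x\<^sub>0, \<dots>, x\<^sub>n\<^sub>-\<^sub>1]\<close>, and \<open>same_cycle\<close> is equality up to rotation and reversal. The set \<open>X2\<close> is
  closed under \<open>same_cycle\<close>. The value \<open>cobdry \<alpha> c\<close> changes only its sign under reversal, so its
  vanishing depends on the cycle alone.
\<close>

definition is_cycle :: "('a \<Rightarrow> 'a \<Rightarrow> real) \<Rightarrow> 'a list \<Rightarrow> bool" where
  "is_cycle w c \<longleftrightarrow>
     length c \<ge> 3 \<and> distinct c \<and> successively (adj w) c \<and> adj w (last c) (hd c)"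

definition same_cycle :: "'a list \<Rightarrow> 'a list \<Rightarrow> bool" where
  "same_cycle c c' \<longleftrightarrow> (\<exists>k. c' = rotate k c \<or> c' = rotate k (rev c))"

definition X2_labeling :: "('a \<Rightarrow> 'a \<Rightarrow> real) \<Rightarrow> ('a \<Rightarrow> 'a \<Rightarrow> real) \<Rightarrow> 'a list \<Rightarrow> bool" where
  "X2_labeling w d c \<longleftrightarrow>
     length c = 3 \<or>
     (length c \<ge> 4 \<and>
      d (c ! 0) (c ! 3) < d (c ! 0) (c ! 1) + d (c ! 1) (c ! 2) + d (c ! 2) (c ! 3) \<and>
      geodesic w d (drop 3 c @ [c ! 0]))"

definition X2 :: "('a \<Rightarrow> 'a \<Rightarrow> real) \<Rightarrow> ('a \<Rightarrow> 'a \<Rightarrow> real) \<Rightarrow> 'a list set" where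
  "X2 w d = {c. is_cycle w c \<and> (\<exists>c'. same_cycle c c' \<and> X2_labeling w d c')}"

definition cobdry :: "real ^ 'a ^ 'a \<Rightarrow> 'a::finite list \<Rightarrow> real" where
  "cobdry \<alpha> c = (\<Sum>i<length c. \<alpha> $ (c ! i) $ (c ! ((i + 1) mod length c)))"

definition codiff ::
  "('a::finite \<Rightarrow> 'a \<Rightarrow> real) \<Rightarrow> ('a \<Rightarrow> real) \<Rightarrow> real ^ 'a ^ 'a \<Rightarrow> 'a \<Rightarrow> real" where
  "codiff w mu \<alpha> x = (\<Sum>y\<in>UNIV. trans_prob w mu x y * \<alpha> $ x $ y)"

definition H1 ::
  "('a::finite \<Rightarrow> 'a \<Rightarrow> real) \<Rightarrow> ('a \<Rightarrow> real) \<Rightarrow> ('a \<Rightarrow> 'a \<Rightarrow> real) \<Rightarrow> (real ^ 'a ^ 'a) set" where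
  "H1 w mu d =
     {\<alpha> \<in> one_forms w. (\<forall>c\<in>X2 w d. cobdry \<alpha> c = 0) \<and> (\<forall>x. codiff w mu \<alpha> x = 0)}"

lemma subspace_H1: "subspace (H1 w mu d)"
  unfolding subspace_def H1_def one_forms_def cobdry_def codiff_def
  by (auto simp: sum.distrib distrib_left sum_distrib_left[symmetric] mult.left_commute)

definition betti1 ::
  "('a::finite \<Rightarrow> 'a \<Rightarrow> real) \<Rightarrow> ('a \<Rightarrow> real) \<Rightarrow> ('a \<Rightarrow> 'a \<Rightarrow> real) \<Rightarrow> nat" where
  "betti1 w mu d = dim (H1 w mu d)"

definition ollivier_betti_sharp ::
  "('a::finite \<Rightarrow> 'a \<Rightarrow> real) \<Rightarrow> ('a \<Rightarrow> real) \<Rightarrow> ('a \<Rightarrow> 'a \<Rightarrow> real) \<Rightarrow> bool" where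
  "ollivier_betti_sharp w mu d \<longleftrightarrow>
     nonneg_ollivier_curvature w mu d \<and> real (betti1 w mu d) = real (max_degree w) / 2"

definition weighted_flat_torus ::
  "'a::finite monoid \<Rightarrow> nat \<Rightarrow> (nat \<Rightarrow> 'a) \<Rightarrow>
   ('a \<Rightarrow> 'a \<Rightarrow> real) \<Rightarrow> ('a \<Rightarrow> real) \<Rightarrow> ('a \<Rightarrow> 'a \<Rightarrow> real) \<Rightarrow> bool" where
  "weighted_flat_torus \<Gamma> m a w mu d \<longleftrightarrow>
     comm_group \<Gamma> \<and> carrier \<Gamma> = UNIV \<and>
     generate \<Gamma> (a ` {1..m}) = carrier \<Gamma> \<and>
     (\<forall>i\<in>{1..m}. \<forall>j\<in>{1..m}. i \<noteq> j \<longrightarrow> a i \<noteq> a j \<and> a i \<noteq> inv\<^bsub>\<Gamma>\<^esub> (a j)) \<and>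
     (\<forall>x y. w x y > 0 \<longleftrightarrow> (\<exists>i\<in>{1..m}. y = a i \<otimes>\<^bsub>\<Gamma>\<^esub> x \<or> y = inv\<^bsub>\<Gamma>\<^esub> (a i) \<otimes>\<^bsub>\<Gamma>\<^esub> x)) \<and>
     (\<forall>x. \<forall>i\<in>{1..m}.
        w x (a i \<otimes>\<^bsub>\<Gamma>\<^esub> x) * d x (a i \<otimes>\<^bsub>\<Gamma>\<^esub> x) =
        w x (inv\<^bsub>\<Gamma>\<^esub> (a i) \<otimes>\<^bsub>\<Gamma>\<^esub> x) * d x (inv\<^bsub>\<Gamma>\<^esub> (a i) \<otimes>\<^bsub>\<Gamma>\<^esub> x)) \<and>
     (\<forall>x. \<forall>i\<in>{1..m}. \<forall>j\<in>{1..m}. i \<noteq> j \<longrightarrow>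
        (\<forall>e1\<in>{1, -1::int}. \<forall>e2\<in>{1, -1::int}.
           trans_prob w mu x (a i [^]\<^bsub>\<Gamma>\<^esub> e1 \<otimes>\<^bsub>\<Gamma>\<^esub> x) =
           trans_prob w mu (a j [^]\<^bsub>\<Gamma>\<^esub> e2 \<otimes>\<^bsub>\<Gamma>\<^esub> x)
             (a i [^]\<^bsub>\<Gamma>\<^esub> e1 \<otimes>\<^bsub>\<Gamma>\<^esub> (a j [^]\<^bsub>\<Gamma>\<^esub> e2 \<otimes>\<^bsub>\<Gamma>\<^esub> x)))) \<and>
     (\<forall>x. \<forall>i\<in>{1..m}. \<forall>j\<in>{1..m}. i \<noteq> j \<longrightarrow>
        d x (a i \<otimes>\<^bsub>\<Gamma>\<^esub> x) = d (a j \<otimes>\<^bsub>\<Gamma>\<^esub> x) (a i \<otimes>\<^bsub>\<Gamma>\<^esub> (a j \<otimes>\<^bsub>\<Gamma>\<^esub> x))) \<and>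
     betti1 w mu d = m"

end

theory Submission imports Defs begin

text \<open>
  Let \<open>\<alpha> \<in> H\<^sub>1\<close> and let the slope \<open>\<alpha>(x,y) / d(x,y)\<close> be maximal on the edge \<open>x \<sim> y\<close>, say equal to \<open>1\<close>. Vanishing on
  \<open>X\<^sub>2\<close> makes \<open>\<alpha>(u,x) + \<alpha>(x,y) + \<alpha>(y,v) \<le> d(u,v)\<close> for \<open>u \<sim> x\<close> and \<open>v \<sim> y\<close>, and \<open>\<delta>\<^sup>*\<alpha> = 0\<close> forces equality on
  the support of every coupling of \<open>p(x,\<cdot>)\<close> and \<open>p(y,\<cdot>)\<close> of cost at most \<open>d(x,y)\<close>. Such couplings exist when
  \<open>\<kappa>\<^sub>1 \<ge> 0\<close>, and it follows that the maximal slope is attained at every vertex.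

  Hence the functionals \<open>\<alpha> \<mapsto> \<alpha>(x,y) / d(x,y)\<close>, \<open>y \<sim> x\<close>, span at every vertex \<open>x\<close> the same symmetric polytope in the
  dual of \<open>H\<^sub>1\<close>. If there are at most \<open>2 dim H\<^sub>1\<close> of them, they are \<open>\<plusminus>\<close> a basis, so each of these functionals
  \<open>s\<close> determines a permutation \<open>T\<^sub>s\<close> of \<open>V\<close>. Testing the couplings with dual basis elements shows that mass is
  transported from \<open>T\<^sub>t x\<close> to \<open>T\<^sub>t T\<^sub>s x\<close>; thus the \<open>T\<^sub>s\<close> commute, \<open>p\<close> and \<open>d\<close> are invariant, and \<open>V\<close> is
  identified with the abelian group generated by the \<open>T\<^sub>s\<close>. The dual basis elements also show that no coupling
  beats \<open>d(x,y)\<close>, which is bone-idleness. Conversely, translations of a flat torus with constant \<open>\<mu>\<close> and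
  \<open>d(x, a\<^sub>i x)\<close> provide couplings of cost \<open>d(x,y)\<close>, and all degrees are at most \<open>2m\<close>.
\<close>

section \<open>Paths and geodesics\<close>

lemma path_length_simps [simp]:
  "path_length f [] = 0" "path_length f [x] = 0"
  "path_length f (x # y # zs) = f x y + path_length f (y # zs)"
proof -
  have "path_length f (x # y # zs) = (\<Sum>k = Suc 0..<Suc (Suc (length zs)). f ((x#y#zs) ! (k - 1)) ((x#y#zs) ! k))"
    by (simp add: path_length_def)
  also have "\<dots> = f x y + (\<Sum>k = Suc (Suc 0)..<Suc (Suc (length zs)). f ((x#y#zs) ! (k - 1)) ((x#y#zs) ! k))"
    by (subst sum.atLeast_Suc_lessThan) simp_all
  also have "(\<Sum>k = Suc (Suc 0)..<Suc (Suc (length zs)). f ((x#y#zs) ! (k - 1)) ((x#y#zs) ! k))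
      = (\<Sum>k = Suc 0..<Suc (length zs). f ((y#zs) ! (k - 1)) ((y#zs) ! k))"
    by (subst sum.shift_bounds_Suc_ivl) (auto intro!: sum.cong simp: nth_Cons')
  finally show "path_length f (x # y # zs) = f x y + path_length f (y # zs)"
    by (simp add: path_length_def)
qed (simp_all add: path_length_def)

lemma path_length_append:
  "path_length f (xs @ z # ys) = path_length f (xs @ [z]) + path_length f (z # ys)"
proof (induction xs)
  case (Cons x xs) then show ?case by (cases xs) auto
qed simp

lemma cobdry_eq_path_length:
  assumes "c \<noteq> []"
  shows "cobdry \<alpha> c = path_length (\<lambda>x y. \<alpha> $ x $ y) (c @ [hd c])"
proof -
  have "path_length (\<lambda>x y. \<alpha> $ x $ y) (c @ [hd c])
      = (\<Sum>k<length c. \<alpha> $ ((c @ [hd c]) ! k) $ ((c @ [hd c]) ! Suc k))"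
    by (simp only: path_length_def atLeast0LessThan[symmetric] One_nat_def length_append_singleton
      sum.shift_bounds_Suc_ivl diff_Suc_Suc diff_zero)
  also have "\<dots> = cobdry \<alpha> c"
    unfolding cobdry_def
  proof (rule sum.cong)
    fix k assume k: "k \<in> {..<length c}"
    show "\<alpha> $ ((c @ [hd c]) ! k) $ ((c @ [hd c]) ! Suc k) = \<alpha> $ (c ! k) $ (c ! ((k + 1) mod length c))"
    proof (cases "Suc k = length c")
      case True
      then show ?thesis using k assms by (simp add: nth_append hd_conv_nth)
    next
      case False
      then show ?thesis using k by (simp add: nth_append)
    qed
  qed simp
  finally show ?thesis ..
qed

lemma successively_append_Cons:
  "successively P (xs @ z # ys) \<longleftrightarrow> successively P (xs @ [z]) \<and> successively P (z # ys)"
  by (auto simp: successively_append_iff)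

lemma graph_path_simps [simp]:
  "graph_path w [x]"
  "graph_path w (x # y # zs) \<longleftrightarrow> adj w x y \<and> graph_path w (y # zs)"
  by (auto simp: graph_path_def)

lemma is_cycleI:
  assumes "length c \<ge> 3" "distinct c" "successively (adj w) (c @ [hd c])"
  shows "is_cycle w c"
proof -
  have "c \<noteq> []" using assms(1) by auto
  then show ?thesis using assms by (auto simp: is_cycle_def successively_append_iff)
qed

lemma X2I:
  assumes "is_cycle w c" "X2_labeling w d c"
  shows "c \<in> X2 w d"
  unfolding X2_def same_cycle_def using assms by (auto intro!: exI[of _ c] exI[of _ 0])

section \<open>Metric geometry of the path distance on a finite connected graph\<close>

locale markov_graph =
  fixes w :: "'a::finite \<Rightarrow> 'a \<Rightarrow> real" and mu :: "'a \<Rightarrow> real" and d :: "'a \<Rightarrow> 'a \<Rightarrow> real"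
  assumes weighted: "weighted_graph w mu"
    and conn: "connected_graph w"
    and path_dist: "path_distance w d"
    and total_weight: "\<And>x. (\<Sum>y\<in>UNIV. w x y) = mu x"
begin

abbreviation "p \<equiv> trans_prob w mu"
abbreviation "nbr \<equiv> adj w"

lemma w_sym: "w x y = w y x" and w_nonneg: "w x y \<ge> 0" and w_diag: "w x x = 0"
  and mu_pos: "mu x > 0"
  using weighted by (auto simp: weighted_graph_def)

lemma nbr_sym: "nbr x y \<longleftrightarrow> nbr y x" and nbr_irrefl [simp]: "\<not> nbr x x"
  by (auto simp: adj_def w_sym w_diag)

lemma nbr_neq: "nbr x y \<Longrightarrow> x \<noteq> y" by auto

lemma d_nonneg: "d x y \<ge> 0" and d_sym: "d x y = d y x" and d_eq_0 [simp]: "d x y = 0 \<longleftrightarrow> x = y"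
  using path_dist[unfolded path_distance_def] by metis+

lemma d_refl [simp]: "d x x = 0"
  by simp

lemma d_Inf: "d x y = Inf {path_length d xs | xs. graph_path w xs \<and> hd xs = x \<and> last xs = y}"
  using path_dist[unfolded path_distance_def] by metis

lemma d_pos: "x \<noteq> y \<Longrightarrow> d x y > 0" "nbr x y \<Longrightarrow> d x y > 0"
  using d_nonneg[of x y] d_eq_0[of x y] nbr_neq[of x y] by linarith+

lemma path_length_nonneg: "path_length d xs \<ge> 0"
  unfolding path_length_def by (intro sum_nonneg d_nonneg)

lemma d_le_path_length:
  assumes "graph_path w xs"
  shows "d (hd xs) (last xs) \<le> path_length d xs"
  by (subst d_Inf, rule cInf_lower)
     (use assms path_length_nonneg in \<open>auto intro!: bdd_belowI[of _ 0]\<close>)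

text \<open>Connectedness as an induction rule; its main use is to turn invariance along edges into
  constancy on the whole graph.\<close>

lemma nbr_induct [consumes 0, case_names base step]:
  assumes "P x" "\<And>x y. P x \<Longrightarrow> nbr x y \<Longrightarrow> P y"
  shows "P y"
proof -
  obtain xs where "graph_path w xs" "hd xs = x" "last xs = y"
    using conn unfolding connected_graph_def by blast
  then show ?thesis using assms(1)
  proof (induction xs arbitrary: x)
    case (Cons a xs)
    show ?case
    proof (cases xs)
      case Nil then show ?thesis using Cons by auto
    next
      case (Cons b ys)
      then show ?thesis using Cons.IH[of b] Cons.prems assms(2)[of a b] by auto
    qed
  qed (auto simp: graph_path_def)
qed

text \<open>Prepending the edge to any path from \<open>z\<close> to \<open>y\<close> gives a path
  from \<open>x\<close> to \<open>y\<close>.\<close>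

lemma d_le_step:
  assumes "nbr x z"
  shows "d x y \<le> d x z + d z y"
proof -
  have "d x y - d x z \<le> d z y"
    unfolding d_Inf[of z y]
  proof (rule cInf_greatest)
    show "{path_length d xs |xs. graph_path w xs \<and> hd xs = z \<and> last xs = y} \<noteq> {}"
      using conn unfolding connected_graph_def by blast
  next
    fix l assume "l \<in> {path_length d xs |xs. graph_path w xs \<and> hd xs = z \<and> last xs = y}"
    then obtain xs where xs: "graph_path w xs" "hd xs = z" "last xs = y" "l = path_length d xs" by auto
    then obtain zs where "xs = z # zs" by (cases xs) (auto simp: graph_path_def)
    then show "d x y - d x z \<le> l" using xs assms d_le_path_length[of "x # xs"] by auto
  qed
  then show ?thesis by simp
qed

text \<open>Every path from \<open>x\<close> to \<open>y\<close> is at least as long as the minimum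
  of \<open>d x z + d z y\<close> over the finitely many neighbours \<open>z\<close> of
  \<open>x\<close>, so the infimum defining \<open>d x y\<close> is attained in its first
  step.\<close>

lemma first_step:
  assumes "x \<noteq> y"
  obtains z where "nbr x z" "d x y = d x z + d z y"
proof -
  define m where "m = Min ((\<lambda>z. d x z + d z y) ` {z. nbr x z})"
  have len: "path_length d xs \<ge> m \<and> {z. nbr x z} \<noteq> {}" if xs: "graph_path w xs" "hd xs = x" "last xs = y" for xs
  proof -
    obtain z zs where "xs = x # z # zs"
      using xs assms by (cases xs; cases "tl xs") (auto simp: graph_path_def)
    then have "nbr x z" "path_length d xs = d x z + path_length d (z # zs)" "graph_path w (z # zs)"
      "last (z # zs) = y"
      using xs by auto
    moreover have "m \<le> d x z + d z y" unfolding m_def using \<open>nbr x z\<close> by (intro Min_le) auto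
    ultimately show ?thesis using d_le_path_length[of "z # zs"] by auto
  qed
  obtain xs0 where xs0: "graph_path w xs0" "hd xs0 = x" "last xs0 = y"
    using conn unfolding connected_graph_def by blast
  have "m \<le> d x y"
    by (subst d_Inf, rule cInf_greatest) (use xs0 len in auto)
  moreover have "m \<in> (\<lambda>z. d x z + d z y) ` {z. nbr x z}"
    unfolding m_def using len[OF xs0] by (intro Min_in) auto
  then obtain z where z: "nbr x z" "m = d x z + d z y" by auto
  moreover have "d x y \<le> d x z + d z y" using z by (intro d_le_step)
  ultimately show ?thesis using that[of z] by auto
qed

text \<open>Induction along a geodesic towards \<open>y\<close>: each first step strictly decreases
  the number of vertices that are closer to \<open>y\<close>.\<close>

lemma d_induct [case_names refl step]:
  assumes "P y" and "\<And>x z. nbr x z \<Longrightarrow> d x y = d x z + d z y \<Longrightarrow> P z \<Longrightarrow> P x"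
  shows "P x"
proof (induction "card {u. d u y < d x y}" arbitrary: x rule: less_induct)
  case less
  show ?case
  proof (cases "x = y")
    case False
    then obtain z where z: "nbr x z" "d x y = d x z + d z y" by (rule first_step)
    then have lt: "d z y < d x y" using d_pos by fastforce
    have "{u. d u y < d z y} \<subset> {u. d u y < d x y}" using lt by auto
    then have "P z" using less by (simp add: psubset_card_mono)
    then show ?thesis using assms(2) z by blast
  qed (use assms in simp)
qed

lemma triangle: "d x z \<le> d x y + d y z"
proof (induction x rule: d_induct[of _ y])
  case refl then show ?case using d_nonneg by simp
next
  case (step x u)
  then show ?case using d_le_step[of x u z] by simp
qed

lemma geodesic_Cons:
  "geodesic w d (x # y # zs) \<longleftrightarrow>
     nbr x y \<and> geodesic w d (y # zs) \<and> d x (last (y # zs)) = d x y + d y (last (y # zs))"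
  (is "?l \<longleftrightarrow> ?r")
proof
  assume ?l
  then show ?r
    using d_le_path_length[of "y # zs"] triangle[of x "last (y # zs)" y]
    by (auto simp: geodesic_def simp del: last.simps simp: last_ConsR[of "y # zs"])
qed (auto simp: geodesic_def)

lemma geodesic_single [simp]: "geodesic w d [x]"
  by (simp add: geodesic_def)

lemma geodesic_pair [simp]: "geodesic w d [x, y] \<longleftrightarrow> nbr x y"
  by (auto simp: geodesic_Cons)

lemma geodesic_exists:
  obtains xs where "geodesic w d xs" "hd xs = x" "last xs = y"
proof -
  have "\<exists>xs. geodesic w d (x # xs) \<and> last (x # xs) = y"
  proof (induction x rule: d_induct[of _ y])
    case refl then show ?case by (intro exI[of _ "[]"]) simp
  next
    case (step x z)
    then obtain xs where "geodesic w d (z # xs)" "last (z # xs) = y" by blast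
    then show ?case using step by (intro exI[of _ "z # xs"]) (simp add: geodesic_Cons)
  qed
  then show ?thesis using that by auto
qed

lemma geodesic_through:
  assumes "geodesic w d xs" "z \<in> set xs"
  shows "d (hd xs) (last xs) = d (hd xs) z + d z (last xs)"
  using assms
proof (induction xs)
  case (Cons x xs)
  show ?case
  proof (cases xs)
    case Nil then show ?thesis using Cons by auto
  next
    case c: (Cons y ys)
    show ?thesis
    proof (cases "z = x")
      case True then show ?thesis by simp
    next
      case False
      then have "d y (last xs) = d y z + d z (last xs)"
        using Cons c by (auto simp: geodesic_Cons)
      moreover have "d x (last xs) = d x y + d y (last xs)"
        using Cons c by (auto simp: geodesic_Cons)
      ultimately show ?thesis
        using triangle[of x z y] triangle[of x "last xs" z] c by simp
    qed
  qed
qed simp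

lemma geodesic_distinct: "geodesic w d xs \<Longrightarrow> distinct xs"
proof (induction xs)
  case (Cons x xs)
  show ?case
  proof (cases xs)
    case c: (Cons y ys)
    have g: "geodesic w d xs" "nbr x y" "d x (last xs) = d x y + d y (last xs)"
      using Cons.prems c by (auto simp: geodesic_Cons)
    have "x \<notin> set xs"
    proof
      assume "x \<in> set xs"
      from geodesic_through[OF g(1) this] have "d x y = 0"
        using g(3) c d_sym[of x y] d_nonneg[of x y] by simp
      then show False using g(2) by simp
    qed
    then show ?thesis using Cons g by simp
  qed simp
qed simp

lemma geodesic_tl: "geodesic w d (x # xs) \<Longrightarrow> xs \<noteq> [] \<Longrightarrow> geodesic w d xs"
  by (cases xs) (auto simp: geodesic_Cons)

end

section \<open>Forms closed on short cycles\<close>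

context markov_graph
begin

text \<open>\<open>H1\<close> without the condition on \<open>codiff\<close>: replacing short paths
  by geodesics uses closedness alone.\<close>

definition X2_closed :: "real ^ 'a ^ 'a \<Rightarrow> bool" where
  "X2_closed \<alpha> \<longleftrightarrow> \<alpha> \<in> one_forms w \<and> (\<forall>c\<in>X2 w d. cobdry \<alpha> c = 0)"

abbreviation along :: "real ^ 'a ^ 'a \<Rightarrow> 'a list \<Rightarrow> real" where
  "along \<alpha> \<equiv> path_length (\<lambda>x y. \<alpha> $ x $ y)"

lemma one_form_zero: "\<alpha> \<in> one_forms w \<Longrightarrow> \<not> nbr x y \<Longrightarrow> \<alpha> $ x $ y = 0"
  unfolding one_forms_def by blast

lemma form_antisym:
  assumes "\<alpha> \<in> one_forms w"
  shows "\<alpha> $ x $ y = - \<alpha> $ y $ x"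
proof (cases "nbr x y")
  case True
  then show ?thesis using assms unfolding one_forms_def by blast
next
  case False
  then show ?thesis using assms nbr_sym[of x y] by (simp add: one_form_zero)
qed

lemma closed_triangle:
  assumes "X2_closed \<alpha>" "nbr x y" "nbr y z" "nbr z x"
  shows "\<alpha> $ x $ y + \<alpha> $ y $ z + \<alpha> $ z $ x = 0"
proof -
  have "is_cycle w [x, y, z]"
    using assms nbr_neq[of x y] nbr_neq[of y z] nbr_neq[of z x] by (intro is_cycleI) auto
  then have "[x, y, z] \<in> X2 w d" by (rule X2I) (simp add: X2_labeling_def)
  then show ?thesis using assms(1) cobdry_eq_path_length[of "[x, y, z]" \<alpha>] by (auto simp: X2_closed_def)
qed

text \<open>Going from \<open>last \<gamma>\<close> to \<open>hd \<gamma>\<close> by the two or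
  three edges of \<open>ps @ [hd \<gamma>]\<close> and back along \<open>\<gamma>\<close> is a cycle
  of \<open>X2\<close>. With three edges the geodesic remainder of the labeling is
  \<open>\<gamma>\<close> itself. With two, unless the cycle is a triangle, the first edge of
  \<open>\<gamma>\<close> serves as the third, the remainder is the rest of \<open>\<gamma>\<close>,
  and \<open>short\<close> yields the strict inequality for these three edges.\<close>

lemma closed_around:
  assumes "X2_closed \<alpha>" "geodesic w d \<gamma>" "length ps \<ge> 2" "length ps \<le> 3" "hd \<gamma> \<noteq> last \<gamma>"
    and "hd ps = last \<gamma>" "distinct ps" "set ps \<inter> set \<gamma> = {last \<gamma>}"
    and "successively nbr (ps @ [hd \<gamma>])"
    and short: "d (last \<gamma>) (hd \<gamma>) < path_length d (ps @ [hd \<gamma>])"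
  shows "along \<alpha> (ps @ [hd \<gamma>]) + along \<alpha> \<gamma> = 0"
proof -
  define c where "c = ps @ butlast \<gamma>"
  have ne: "\<gamma> \<noteq> []" "ps \<noteq> []" using assms(2,3) by (auto simp: geodesic_def graph_path_def)
  obtain a \<gamma>' where \<gamma>: "\<gamma> = a # \<gamma>'" "\<gamma>' \<noteq> []"
    using ne \<open>hd \<gamma> \<noteq> last \<gamma>\<close> by (cases \<gamma>) (auto split: if_splits)
  have cl: "c @ [hd c] = ps @ \<gamma>"
    unfolding c_def using ne assms(6) by (simp add: append_butlast_last_id)
  have dist\<gamma>: "distinct (butlast \<gamma> @ [last \<gamma>])" using geodesic_distinct[OF assms(2)] ne by simp
  have "set ps \<inter> set (butlast \<gamma>) \<subseteq> {last \<gamma>}" using assms(8) in_set_butlastD[of _ \<gamma>] by blast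
  then have "distinct c"
    using dist\<gamma> assms(7) unfolding c_def by auto
  moreover have "successively nbr (c @ [hd c])"
    unfolding cl using assms(2,9) \<gamma> successively_append_Cons[of nbr ps a \<gamma>']
    by (auto simp: geodesic_def graph_path_def)
  moreover have len: "length c = length ps + length \<gamma>'" unfolding c_def \<gamma> by simp
  then have len3: "length c \<ge> 3" using assms(3) \<gamma>(2) by (cases \<gamma>') auto
  ultimately have cyc: "is_cycle w c" by (intro is_cycleI)
  have "X2_labeling w d c"
  proof (cases "length c = 3")
    case False
    show ?thesis
    proof (cases "length ps = 3")
      case True
      then obtain u x y where "ps = [u, x, y]"
        by (auto simp: length_Suc_conv numeral_3_eq_3)
      moreover have "drop 3 c @ [c ! 0] = \<gamma>"
        using calculation ne assms(6) by (simp add: c_def)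
      ultimately show ?thesis using assms(2) short False len3 \<gamma> assms(6)
        by (simp add: X2_labeling_def c_def Suc_le_eq)
    next
      case f2: False
      then have "length ps = 2" using assms(3,4) by auto
      then obtain u x where ps: "ps = [u, x]"
        by (auto simp: length_Suc_conv numeral_2_eq_2)
      then obtain b \<gamma>'' where \<gamma>': "\<gamma>' = b # \<gamma>''" "\<gamma>'' \<noteq> []"
        using False len3 len by (cases \<gamma>'; cases "tl \<gamma>'") auto
      have l: "last \<gamma> = u" using ps assms(6) by simp
      have c: "c = u # x # a # b # butlast \<gamma>''" using ps \<gamma> \<gamma>' by (simp add: c_def)
      have "drop 3 c @ [c ! 0] = \<gamma>'"
        using l \<gamma> \<gamma>' by (auto simp: c)
      moreover have "geodesic w d \<gamma>'" using assms(2) \<gamma> by (auto intro: geodesic_tl)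
      moreover have "d a u = d a b + d b u"
        using assms(2) \<gamma> \<gamma>' l by (auto simp: geodesic_Cons)
      then have "d u b < d u x + d x a + d a b"
        using short ps \<gamma> l d_sym[of b u] d_sym[of a u] d_nonneg[of a b] by simp
      ultimately show ?thesis using c by (simp add: X2_labeling_def)
    qed
  qed (simp add: X2_labeling_def)
  then have "cobdry \<alpha> c = 0" using X2I[OF cyc] assms(1) by (auto simp: X2_closed_def)
  moreover have "c \<noteq> []" using len3 by auto
  ultimately show ?thesis
    using cobdry_eq_path_length[of c \<alpha>] cl path_length_append[of _ ps a \<gamma>'] \<gamma> by simp
qed

text \<open>Going back and forth along an edge cancels by antisymmetry, a shortest pair of edges is
  its own geodesic, and a strict detour closes up with any geodesic to a cycle of
  \<open>X2\<close>.\<close>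

lemma geodesic_of_two_steps:
  assumes "X2_closed \<alpha>" "nbr a b" "nbr b e"
  obtains \<gamma> where "geodesic w d \<gamma>" "hd \<gamma> = a" "last \<gamma> = e" "along \<alpha> \<gamma> = \<alpha> $ a $ b + \<alpha> $ b $ e"
proof -
  have anti: "\<alpha> $ x $ y = - \<alpha> $ y $ x" for x y using assms by (intro form_antisym) (simp add: X2_closed_def)
  consider "a = e" | "a \<noteq> e" "d a e = d a b + d b e" | "a \<noteq> e" "d a e < d a b + d b e"
    using triangle[of a e b] by linarith
  then show ?thesis
  proof cases
    case 1 then show ?thesis using that[of "[a]"] anti[of a b] by simp
  next
    case 2 then show ?thesis using that[of "[a, b, e]"] assms by (simp add: geodesic_Cons)
  next
    case 3
    obtain \<gamma> where \<gamma>: "geodesic w d \<gamma>" "hd \<gamma> = a" "last \<gamma> = e" by (rule geodesic_exists)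
    have "e \<in> set \<gamma>" using \<gamma> by (metis geodesic_def graph_path_def last_in_set)
    moreover have "b \<notin> set \<gamma>" using geodesic_through[OF \<gamma>(1), of b] 3 \<gamma> by auto
    ultimately have "along \<alpha> ([e, b] @ [hd \<gamma>]) + along \<alpha> \<gamma> = 0"
      using assms 3 \<gamma> nbr_sym nbr_neq d_sym[of e b] d_sym[of b a] d_sym[of a e]
      by (intro closed_around) auto
    then show ?thesis using that[of \<gamma>] \<gamma> anti[of e b] anti[of b a] by simp
  qed
qed

text \<open>As for two edges, but the chosen geodesic may meet an inner vertex \<open>b\<close> or
  \<open>e\<close>. Then \<open>d a f\<close> splits at that vertex, and a geodesic from the
  two-step case is extended by the remaining edge.\<close>

lemma geodesic_of_three_steps:
  assumes "X2_closed \<alpha>" "nbr a b" "nbr b e" "nbr e f"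
  obtains \<gamma> where "geodesic w d \<gamma>" "hd \<gamma> = a" "last \<gamma> = f"
    "along \<alpha> \<gamma> = \<alpha> $ a $ b + \<alpha> $ b $ e + \<alpha> $ e $ f"
proof -
  have anti: "\<alpha> $ x $ y = - \<alpha> $ y $ x" for x y using assms by (intro form_antisym) (simp add: X2_closed_def)
  obtain \<gamma> where \<gamma>: "geodesic w d \<gamma>" "hd \<gamma> = a" "last \<gamma> = f" by (rule geodesic_exists)
  have ne: "\<gamma> \<noteq> []" using \<gamma> by (auto simp: geodesic_def graph_path_def)
  have ends: "a \<in> set \<gamma>" "f \<in> set \<gamma>" using ne \<gamma> by auto
  consider "a = f" | "b \<in> set \<gamma>" | "e \<in> set \<gamma>"
    | "d a f = d a b + d b e + d e f" "a \<noteq> f" "b \<notin> set \<gamma>"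
    | "d a f < d a b + d b e + d e f" "a \<noteq> f" "b \<notin> set \<gamma>" "e \<notin> set \<gamma>"
    using triangle[of a f b] triangle[of b f e] by linarith
  then show ?thesis
  proof cases
    case 1
    then show ?thesis using that[of "[a]"] closed_triangle[OF assms(1), of a b e] assms by simp
  next
    case 2
    then have *: "d a f = d a b + d b f" using geodesic_through[OF \<gamma>(1)] \<gamma> by auto
    obtain \<gamma>' where \<gamma>': "geodesic w d \<gamma>'" "hd \<gamma>' = b" "last \<gamma>' = f" "along \<alpha> \<gamma>' = \<alpha> $ b $ e + \<alpha> $ e $ f"
      using geodesic_of_two_steps[OF assms(1,3,4)] .
    then obtain t where "\<gamma>' = b # t" by (cases \<gamma>') (auto simp: geodesic_def graph_path_def)
    then show ?thesis using that[of "a # \<gamma>'"] \<gamma>' * assms by (simp add: geodesic_Cons)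
  next
    case 3
    then have *: "d a f = d a e + d e f" using geodesic_through[OF \<gamma>(1)] \<gamma> by auto
    obtain \<gamma>' where \<gamma>': "geodesic w d \<gamma>'" "hd \<gamma>' = a" "last \<gamma>' = e" "along \<alpha> \<gamma>' = \<alpha> $ a $ b + \<alpha> $ b $ e"
      using geodesic_of_two_steps[OF assms(1,2,3)] .
    then obtain t where t: "\<gamma>' = t @ [e]" by (cases \<gamma>' rule: rev_cases) (auto simp: geodesic_def graph_path_def)
    have "geodesic w d (\<gamma>' @ [f])"
      using \<gamma>' t assms * path_length_append[of d t e "[f]"] successively_append_Cons[of nbr t e "[f]"]
      by (cases t) (auto simp: geodesic_def graph_path_def)
    then show ?thesis using that[of "\<gamma>' @ [f]"] \<gamma>' t path_length_append[of "\<lambda>x y. \<alpha> $ x $ y" t e "[f]"]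
      by (cases t) auto
  next
    case 4
    then have "d b f = d b e + d e f" using triangle[of a f b] triangle[of b f e] by linarith
    then show ?thesis using that[of "[a, b, e, f]"] assms 4 by (simp add: geodesic_Cons)
  next
    case 5
    then have "along \<alpha> ([f, e, b] @ [hd \<gamma>]) + along \<alpha> \<gamma> = 0"
      using assms 5 \<gamma> ends nbr_sym nbr_neq d_sym[of e b] d_sym[of b a] d_sym[of a f] d_sym[of e f]
      by (intro closed_around) auto
    then show ?thesis using that[of \<gamma>] \<gamma> anti[of e b] anti[of b a] anti[of f e] by simp
  qed
qed

end

section \<open>Couplings along edges of maximal slope\<close>

lemma coupling_sum_add:
  assumes "coupling m m' \<rho>"
  shows "(\<Sum>u\<in>UNIV. \<Sum>v\<in>UNIV. \<rho> u v * (g u + h v)) = (\<Sum>u\<in>UNIV. m u * g u) + (\<Sum>v\<in>UNIV. m' v * h v)"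
proof -
  have "(\<Sum>u\<in>UNIV. \<Sum>v\<in>UNIV. \<rho> u v * h v) = (\<Sum>v\<in>UNIV. \<Sum>u\<in>UNIV. \<rho> u v * h v)"
    by (rule sum.swap)
  then show ?thesis
    using assms by (simp add: coupling_def distrib_left sum.distrib flip: sum_distrib_right)
qed

lemma coupling_le_marginals:
  assumes "coupling m m' \<rho>"
  shows "\<rho> u v \<le> m u" "\<rho> u v \<le> m' v"
proof -
  show "\<rho> u v \<le> m u"
    using assms member_le_sum[of v UNIV "\<rho> u"] by (auto simp: coupling_def)
  show "\<rho> u v \<le> m' v"
    using assms member_le_sum[of u UNIV "\<lambda>u. \<rho> u v"] by (auto simp: coupling_def)
qed

lemma coupling_zero:
  assumes "coupling m m' \<rho>" "\<not> \<rho> u v > 0"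
  shows "\<rho> u v = 0"
proof -
  have "\<rho> u v \<ge> 0" using assms(1) by (simp add: coupling_def)
  then show ?thesis using assms(2) by simp
qed

lemma coupling_row_concentrated:
  assumes "coupling m m' \<rho>" "\<And>v'. v' \<noteq> v \<Longrightarrow> \<rho> u v' = 0"
  shows "\<rho> u v = m u"
proof -
  have "m u = (\<Sum>v'\<in>UNIV. \<rho> u v')" using assms by (simp add: coupling_def)
  also have "\<dots> = (\<Sum>v'\<in>{v}. \<rho> u v')" using assms by (intro sum.mono_neutral_right) auto
  finally show ?thesis by simp
qed

lemma coupling_column_concentrated:
  assumes "coupling m m' \<rho>" "\<And>u'. u' \<noteq> u \<Longrightarrow> \<rho> u' v = 0"
  shows "\<rho> u v = m' v"
proof -
  have "m' v = (\<Sum>u'\<in>UNIV. \<rho> u' v)" using assms by (simp add: coupling_def)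
  also have "\<dots> = (\<Sum>u'\<in>{u}. \<rho> u' v)" using assms by (intro sum.mono_neutral_right) auto
  finally show ?thesis by simp
qed

abbreviation transport_cost :: "('a::finite \<Rightarrow> 'a \<Rightarrow> real) \<Rightarrow> ('a \<Rightarrow> 'a \<Rightarrow> real) \<Rightarrow> real" where
  "transport_cost d \<rho> \<equiv> \<Sum>u\<in>UNIV. \<Sum>v\<in>UNIV. \<rho> u v * d u v"

context markov_graph
begin

lemma p_nonneg: "p x y \<ge> 0" and p_pos_iff: "p x y > 0 \<longleftrightarrow> nbr x y" and p_eq_0: "\<not> nbr x y \<Longrightarrow> p x y = 0"
  using w_nonneg[of x y] mu_pos[of x] by (auto simp: trans_prob_def adj_def field_simps)

lemma sum_p: "(\<Sum>y\<in>UNIV. p x y) = 1"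
  using mu_pos[of x] by (simp add: trans_prob_def total_weight flip: sum_divide_distrib)

lemma lazy_walk_1: "lazy_walk w mu 1 x = p x"
  by (auto simp: lazy_walk_def trans_prob_def w_diag)

lemma sum_lazy_walk:
  "(\<Sum>u\<in>UNIV. lazy_walk w mu \<epsilon> x u * f u) = (1 - \<epsilon>) * f x + \<epsilon> * (\<Sum>u\<in>UNIV. p x u * f u)"
proof -
  have "lazy_walk w mu \<epsilon> x u * f u = (if u = x then (1 - \<epsilon>) * f u else 0) + \<epsilon> * (p x u * f u)" for u
    by (simp add: lazy_walk_def trans_prob_def w_diag)
  then show ?thesis by (simp add: sum.distrib sum_distrib_left)
qed

lemma exists_nbr: "\<exists>y. nbr x y"
proof (rule ccontr)
  assume "\<nexists>y. nbr x y"
  then have "p x y = 0" for y by (simp add: p_eq_0)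
  then show False using sum_p[of x] by simp
qed

lemma H1_closed: "\<alpha> \<in> H1 w mu d \<Longrightarrow> X2_closed \<alpha>"
  and H1_one_form: "\<alpha> \<in> H1 w mu d \<Longrightarrow> \<alpha> \<in> one_forms w"
  and H1_codiff: "\<alpha> \<in> H1 w mu d \<Longrightarrow> (\<Sum>y\<in>UNIV. p x y * \<alpha> $ x $ y) = 0"
  by (auto simp: H1_def X2_closed_def codiff_def)

text \<open>A one-sided bound is enough, since antisymmetry turns it into a bound on absolute
  values.\<close>

definition slope_le :: "real ^ 'a ^ 'a \<Rightarrow> real \<Rightarrow> bool" where
  "slope_le \<alpha> c \<longleftrightarrow> (\<forall>u v. nbr u v \<longrightarrow> \<alpha> $ u $ v \<le> c * d u v)"

lemma along_le:
  assumes "slope_le \<alpha> c"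
  shows "graph_path w \<gamma> \<Longrightarrow> along \<alpha> \<gamma> \<le> c * path_length d \<gamma>"
proof (induction \<gamma>)
  case (Cons x \<gamma>)
  then show ?case using assms by (cases \<gamma>) (fastforce simp: slope_le_def distrib_left)+
qed simp

lemma along_geodesic_le:
  assumes "slope_le \<alpha> c" "geodesic w d \<gamma>"
  shows "along \<alpha> \<gamma> \<le> c * d (hd \<gamma>) (last \<gamma>)"
  using along_le[OF assms(1), of \<gamma>] assms(2) by (auto simp: geodesic_def)

lemma three_steps_le:
  assumes "X2_closed \<alpha>" "slope_le \<alpha> c" "nbr u x" "nbr x y" "nbr y v"
  shows "\<alpha> $ u $ x + \<alpha> $ x $ y + \<alpha> $ y $ v \<le> c * d u v"
proof -
  obtain \<gamma> where "geodesic w d \<gamma>" "hd \<gamma> = u" "last \<gamma> = v"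
    "along \<alpha> \<gamma> = \<alpha> $ u $ x + \<alpha> $ x $ y + \<alpha> $ y $ v"
    using geodesic_of_three_steps assms by metis
  then show ?thesis using along_geodesic_le[OF assms(2), of \<gamma>] by simp
qed

lemma two_steps_le:
  assumes "X2_closed \<alpha>" "slope_le \<alpha> c" "nbr u x" "nbr x y"
  shows "\<alpha> $ u $ x + \<alpha> $ x $ y \<le> c * d u y"
proof -
  obtain \<gamma> where "geodesic w d \<gamma>" "hd \<gamma> = u" "last \<gamma> = y" "along \<alpha> \<gamma> = \<alpha> $ u $ x + \<alpha> $ x $ y"
    using geodesic_of_two_steps assms by metis
  then show ?thesis using along_geodesic_le[OF assms(2), of \<gamma>] by simp
qed

text \<open>Equality forces equality on the edges of the replacing geodesic; the first of them
  starts at \<open>u\<close> and exists because \<open>u\<close> differs from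
  \<open>v\<close>.\<close>

lemma three_steps_eq:
  assumes "X2_closed \<alpha>" "slope_le \<alpha> c" "nbr u x" "nbr x y" "nbr y v" "u \<noteq> v"
    and eq: "\<alpha> $ u $ x + \<alpha> $ x $ y + \<alpha> $ y $ v = c * d u v"
  obtains g where "nbr u g" "\<alpha> $ u $ g = c * d u g" "d u v = d u g + d g v"
proof -
  obtain \<gamma> where \<gamma>: "geodesic w d \<gamma>" "hd \<gamma> = u" "last \<gamma> = v"
    "along \<alpha> \<gamma> = \<alpha> $ u $ x + \<alpha> $ x $ y + \<alpha> $ y $ v"
    using geodesic_of_three_steps assms by metis
  obtain g \<gamma>' where g: "\<gamma> = u # g # \<gamma>'"
    using \<gamma>(1,2,3) \<open>u \<noteq> v\<close> by (cases \<gamma>; cases "tl \<gamma>") (auto simp: geodesic_def graph_path_def)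
  then have s: "nbr u g" "geodesic w d (g # \<gamma>')" "d u v = d u g + d g v"
    using \<gamma>(1,3) by (auto simp: geodesic_Cons)
  have "along \<alpha> (g # \<gamma>') \<le> c * d g v" using along_geodesic_le[OF assms(2) s(2)] \<gamma>(3) g by simp
  moreover have "\<alpha> $ u $ g \<le> c * d u g" using assms(2) s(1) by (simp add: slope_le_def)
  moreover have "\<alpha> $ u $ g + along \<alpha> (g # \<gamma>') = c * d u g + c * d g v"
    using \<gamma>(4) g eq s(3) by (simp add: distrib_left)
  ultimately show ?thesis using that s by force
qed

lemma coupling_support:
  assumes "coupling (p x) (p y) \<rho>" "\<rho> u v > 0"
  shows "nbr x u" "nbr y v"
  using coupling_le_marginals[OF assms(1), of u v] assms(2) by (auto simp flip: p_pos_iff)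

text \<open>Complementary slackness. The \<open>gap\<close> terms are nonnegative by
  \<open>three_steps_le\<close>; their sum is \<open>c\<close> times the cost minus
  \<open>\<alpha> $ x $ y\<close>, because the vanishing of \<open>codiff\<close> at
  \<open>x\<close> and \<open>y\<close> removes the outer two terms. A cost of at most
  \<open>d x y\<close> makes this sum nonpositive.\<close>

lemma coupling_parallel:
  assumes \<alpha>: "\<alpha> \<in> H1 w mu d" "slope_le \<alpha> c" "c \<ge> 0"
    and \<rho>: "coupling (p x) (p y) \<rho>" "transport_cost d \<rho> \<le> d x y"
    and xy: "nbr x y" "\<alpha> $ x $ y = c * d x y" and uv: "\<rho> u v > 0"
  shows "\<alpha> $ u $ x + \<alpha> $ x $ y + \<alpha> $ y $ v = c * d u v"
proof -
  define gap where "gap u v = \<rho> u v * (c * d u v - (\<alpha> $ u $ x + \<alpha> $ x $ y + \<alpha> $ y $ v))" for u v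
  have nn: "gap u v \<ge> 0" for u v
  proof (cases "\<rho> u v > 0")
    case True
    have "\<alpha> $ u $ x + \<alpha> $ x $ y + \<alpha> $ y $ v \<le> c * d u v"
      using coupling_support[OF \<rho>(1) True] xy \<alpha> nbr_sym by (intro three_steps_le H1_closed) auto
    then show ?thesis using True by (simp add: gap_def)
  next
    case False
    then have "\<rho> u v = 0" using coupling_zero[OF \<rho>(1)] by blast
    then show ?thesis by (simp add: gap_def)
  qed
  have anti: "\<alpha> $ u $ x = - \<alpha> $ x $ u" for u by (rule form_antisym) (rule H1_one_form[OF \<alpha>(1)])
  have "(\<Sum>u\<in>UNIV. \<Sum>v\<in>UNIV. gap u v) =
      c * transport_cost d \<rho> - (\<Sum>u\<in>UNIV. \<Sum>v\<in>UNIV. \<rho> u v * ((\<alpha> $ u $ x + \<alpha> $ x $ y) + \<alpha> $ y $ v))"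
    by (simp add: gap_def right_diff_distrib sum_subtractf sum_distrib_left mult.left_commute)
  also have "(\<Sum>u\<in>UNIV. \<Sum>v\<in>UNIV. \<rho> u v * ((\<alpha> $ u $ x + \<alpha> $ x $ y) + \<alpha> $ y $ v)) = \<alpha> $ x $ y"
    unfolding coupling_sum_add[OF \<rho>(1)] anti
    using H1_codiff[OF \<alpha>(1), of x] H1_codiff[OF \<alpha>(1), of y] sum_p[of x]
    by (simp add: right_diff_distrib sum_subtractf flip: sum_distrib_right)
  also have "c * transport_cost d \<rho> - \<alpha> $ x $ y \<le> 0"
    using xy \<rho>(2) \<alpha>(3) by (simp add: mult_left_mono)
  finally have "(\<Sum>u\<in>UNIV. \<Sum>v\<in>UNIV. gap u v) \<le> 0" .
  moreover have "gap u v \<le> (\<Sum>v\<in>UNIV. gap u v)" by (rule member_le_sum) (use nn in auto)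
  moreover have "(\<Sum>v\<in>UNIV. gap u v) \<le> (\<Sum>u\<in>UNIV. \<Sum>v\<in>UNIV. gap u v)"
    by (rule member_le_sum) (use nn in \<open>auto intro: sum_nonneg\<close>)
  ultimately have "gap u v = 0" using nn[of u v] by linarith
  then show ?thesis using uv by (simp add: gap_def)
qed

text \<open>Easy half of Kantorovich duality with the potentials
  \<open>\<alpha> $ u $ x + \<alpha> $ x $ y\<close> and \<open>\<alpha> $ y $ v\<close>, whose sum
  is at most \<open>d u v\<close> on the support. Idle mass at \<open>x\<close> or \<open>y\<close>
  is covered by the two-step bounds and the zero diagonal.\<close>

lemma lazy_transport_ge:
  assumes \<alpha>: "\<alpha> \<in> H1 w mu d" "slope_le \<alpha> 1"
    and xy: "nbr x y" "\<alpha> $ x $ y = d x y" and \<rho>: "coupling (lazy_walk w mu \<epsilon> x) (lazy_walk w mu \<epsilon> y) \<rho>"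
  shows "d x y \<le> transport_cost d \<rho>"
proof -
  have anti: "\<alpha> $ u $ x = - \<alpha> $ x $ u" for u x by (rule form_antisym) (rule H1_one_form[OF \<alpha>(1)])
  have diag: "\<alpha> $ u $ u = 0" for u using anti[of u u] by simp
  have le: "\<rho> u v * ((\<alpha> $ u $ x + \<alpha> $ x $ y) + \<alpha> $ y $ v) \<le> \<rho> u v * d u v" for u v
  proof (cases "\<rho> u v > 0")
    case True
    then have "lazy_walk w mu \<epsilon> x u > 0" "lazy_walk w mu \<epsilon> y v > 0"
      using coupling_le_marginals[OF \<rho>, of u v] by linarith+
    then have "u = x \<or> nbr x u" "v = y \<or> nbr y v"
      using p_eq_0[of x u] p_eq_0[of y v]
      by (cases "nbr x u"; cases "nbr y v"; force simp: lazy_walk_def split: if_splits)+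
    then have "u = x \<or> nbr u x" "v = y \<or> nbr y v" using nbr_sym by blast+
    then have "\<alpha> $ u $ x + \<alpha> $ x $ y + \<alpha> $ y $ v \<le> 1 * d u v"
      using three_steps_le[OF H1_closed[OF \<alpha>(1)] \<alpha>(2), of u x y v] xy diag
        two_steps_le[OF H1_closed[OF \<alpha>(1)] \<alpha>(2), of u x y]
        two_steps_le[OF H1_closed[OF \<alpha>(1)] \<alpha>(2), of x y v] by auto
    then show ?thesis using True by simp
  next
    case False
    then have "\<rho> u v = 0" using coupling_zero[OF \<rho>(1)] by blast
    then show ?thesis by simp
  qed
  have "(\<Sum>u\<in>UNIV. lazy_walk w mu \<epsilon> x u * (\<alpha> $ u $ x + \<alpha> $ x $ y)) = \<alpha> $ x $ y"
  proof -
    have "p x u * (\<alpha> $ u $ x + \<alpha> $ x $ y) = p x u * \<alpha> $ x $ y - p x u * \<alpha> $ x $ u" for u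
      by (subst anti[of u x]) (simp add: algebra_simps)
    then have "(\<Sum>u\<in>UNIV. p x u * (\<alpha> $ u $ x + \<alpha> $ x $ y)) = \<alpha> $ x $ y"
      using H1_codiff[OF \<alpha>(1), of x] sum_p[of x] by (simp add: sum_subtractf flip: sum_distrib_right)
    then show ?thesis unfolding sum_lazy_walk by (simp add: diag algebra_simps)
  qed
  moreover have "(\<Sum>v\<in>UNIV. lazy_walk w mu \<epsilon> y v * \<alpha> $ y $ v) = 0"
    unfolding sum_lazy_walk using H1_codiff[OF \<alpha>(1), of y] by (simp add: diag)
  ultimately have "\<alpha> $ x $ y = (\<Sum>u\<in>UNIV. \<Sum>v\<in>UNIV. \<rho> u v * ((\<alpha> $ u $ x + \<alpha> $ x $ y) + \<alpha> $ y $ v))"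
    unfolding coupling_sum_add[OF \<rho>(1)] by simp
  also have "\<dots> \<le> transport_cost d \<rho>" by (intro sum_mono le)
  finally show ?thesis using xy by simp
qed

end

text \<open>The condition \<open>\<kappa>\<^sub>1 \<ge> 0\<close> in the form in which it is used.
  Curvature supplies the coupling by compactness, a flat torus by translations.\<close>

locale nonneg_walk = markov_graph +
  assumes good_coupling: "adj w x y \<Longrightarrow>
    \<exists>\<rho>. coupling (trans_prob w mu x) (trans_prob w mu y) \<rho> \<and> transport_cost d \<rho> \<le> d x y"
begin

lemma slope_attained_everywhere:
  assumes \<alpha>: "\<alpha> \<in> H1 w mu d" "slope_le \<alpha> c" "c > 0" and ex: "nbr x0 y0" "\<alpha> $ x0 $ y0 = c * d x0 y0"
  shows "\<exists>y. nbr x y \<and> \<alpha> $ x $ y = c * d x y"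
proof -
  define M where "M = {x. \<exists>y. nbr x y \<and> \<alpha> $ x $ y = c * d x y}"
  have anti: "\<alpha> $ u $ x = - \<alpha> $ x $ u" for u x by (rule form_antisym) (rule H1_one_form[OF \<alpha>(1)])
  \<comment> \<open>The mass at \<open>u\<close> moves to some \<open>v\<close>. If
    \<open>v = u\<close>, then \<open>u\<close> is a neighbour of \<open>y\<close>; otherwise
    tightness on the pair \<open>u\<close>, \<open>v\<close> produces an edge of maximal slope
    starting at \<open>u\<close>.\<close>
  have step: "u \<in> M \<or> nbr u y" if xy: "nbr x y" "\<alpha> $ x $ y = c * d x y" and u: "nbr x u" for x y u
  proof -
    obtain \<rho> where \<rho>: "coupling (p x) (p y) \<rho>" "transport_cost d \<rho> \<le> d x y"
      using good_coupling[OF xy(1)] by blast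
    have "\<exists>v. \<rho> u v > 0"
    proof (rule ccontr)
      assume "\<nexists>v. \<rho> u v > 0"
      then have "(\<Sum>v\<in>UNIV. \<rho> u v) \<le> 0" by (auto intro!: sum_nonpos simp: not_less)
      moreover have "(\<Sum>v\<in>UNIV. \<rho> u v) = p x u" using \<rho>(1) by (simp add: coupling_def)
      ultimately show False using u p_pos_iff[of x u] by simp
    qed
    then obtain v where v: "\<rho> u v > 0" ..
    have yv: "nbr y v" using coupling_support[OF \<rho>(1) v] by simp
    show ?thesis
    proof (cases "v = u")
      case True
      then show ?thesis using yv nbr_sym by auto
    next
      case False
      have "\<alpha> $ u $ x + \<alpha> $ x $ y + \<alpha> $ y $ v = c * d u v"
        using coupling_parallel[OF \<alpha>(1,2) _ \<rho> xy v] \<alpha>(3) by simp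
      then obtain g where "nbr u g" "\<alpha> $ u $ g = c * d u g"
        using three_steps_eq[OF H1_closed[OF \<alpha>(1)] \<alpha>(2), of u x y v] u xy(1) yv False nbr_sym by metis
      then show ?thesis by (auto simp: M_def)
    qed
  qed
  \<comment> \<open>If a vertex outside \<open>M\<close> had neighbours in \<open>M\<close>, a neighbour maximising \<open>\<alpha> u\<close> among them would
    lead along an edge of extremal slope to another one, with a larger value by the triangle relation.\<close>
  have "u \<in> M" if xM: "x \<in> M" and xu: "nbr x u" for x u
  proof (rule ccontr)
    assume u: "u \<notin> M"
    define A where "A = {z \<in> M. nbr u z}"
    have "A \<noteq> {}" "finite A" using xM xu nbr_sym by (auto simp: A_def)
    then have "Max ((\<lambda>z. \<alpha> $ u $ z) ` A) \<in> (\<lambda>z. \<alpha> $ u $ z) ` A" by (intro Max_in) auto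
    then obtain z where z: "z \<in> A" "\<alpha> $ u $ z = Max ((\<lambda>z. \<alpha> $ u $ z) ` A)" by auto
    then have max: "\<alpha> $ u $ z' \<le> \<alpha> $ u $ z" if "z' \<in> A" for z'
      using that \<open>finite A\<close> by simp
    obtain y where y: "nbr z y" "\<alpha> $ z $ y = c * d z y" using z by (auto simp: A_def M_def)
    have uy: "nbr u y" using step[OF y, of u] u z nbr_sym by (auto simp: A_def)
    \<comment> \<open>With \<open>y\<close> itself as the neighbour of \<open>z\<close>, the
      alternative \<open>nbr y y\<close> is excluded.\<close>
    have "y \<in> M" using step[OF y y(1)] by auto
    then have "\<alpha> $ u $ y \<le> \<alpha> $ u $ z" using uy max by (simp add: A_def)
    moreover have "\<alpha> $ u $ z + \<alpha> $ z $ y + \<alpha> $ y $ u = 0"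
      using z uy y nbr_sym by (intro closed_triangle H1_closed \<alpha>) (auto simp: A_def)
    moreover have "\<alpha> $ z $ y > 0" using y d_pos \<alpha>(3) by simp
    ultimately show False using anti[of y u] by linarith
  qed
  then have "x \<in> M" using ex by (intro nbr_induct[of "\<lambda>x. x \<in> M" x0 x]) (auto simp: M_def)
  then show ?thesis by (simp add: M_def)
qed

end

section \<open>Edge directions\<close>

lemma extreme_point_of_neg:
  fixes S :: "'b::euclidean_space set"
  assumes "e extreme_point_of S"
  shows "- e extreme_point_of (uminus ` S)"
proof -
  have "e \<in> open_segment a b" if "- e \<in> open_segment (- a) (- b)" for a b
    using that by (auto simp: in_segment algebra_simps)
  then show ?thesis using assms by (auto simp: extreme_point_of_def)
qed

context markov_graph
begin

text \<open>The Riesz representative in \<open>H1\<close> of the slope functional, so that the dual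
  space of \<open>H1\<close> is replaced by \<open>H1\<close> itself.\<close>

definition direction :: "'a \<Rightarrow> 'a \<Rightarrow> real ^ 'a ^ 'a" where
  "direction x y = (SOME v. v \<in> H1 w mu d \<and> (\<forall>\<alpha>\<in>H1 w mu d. v \<bullet> \<alpha> = \<alpha> $ x $ y / d x y))"

lemma span_H1 [simp]: "span (H1 w mu d) = H1 w mu d"
  using subspace_H1 by (simp add: span_eq_iff)

lemma direction_props:
  "direction x y \<in> H1 w mu d \<and> (\<forall>\<alpha>\<in>H1 w mu d. direction x y \<bullet> \<alpha> = \<alpha> $ x $ y / d x y)"
  unfolding direction_def
proof (rule someI_ex)
  \<comment> \<open>The matrix representing the functional on the whole space; its orthogonal
    projection to \<open>H1\<close> is the representative.\<close>
  let ?e = "axis x (axis y (1 / d x y)) :: real ^ 'a ^ 'a"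
  obtain v z where vz: "v \<in> span (H1 w mu d)" "\<And>u. u \<in> span (H1 w mu d) \<Longrightarrow> orthogonal z u" "?e = v + z"
    using orthogonal_subspace_decomp_exists by metis
  have "v \<bullet> \<alpha> = \<alpha> $ x $ y / d x y" if "\<alpha> \<in> H1 w mu d" for \<alpha>
  proof -
    have "?e \<bullet> \<alpha> = v \<bullet> \<alpha>" using vz(2)[of \<alpha>] that by (simp add: vz(3) inner_add_left orthogonal_def)
    moreover have "?e \<bullet> \<alpha> = \<alpha> $ x $ y / d x y"
      by (subst inner_commute) (simp add: inner_axis)
    ultimately show ?thesis by simp
  qed
  then show "\<exists>v. v \<in> H1 w mu d \<and> (\<forall>\<alpha>\<in>H1 w mu d. v \<bullet> \<alpha> = \<alpha> $ x $ y / d x y)"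
    using vz(1) by auto
qed

lemma direction_H1: "direction x y \<in> H1 w mu d"
  and inner_direction: "\<alpha> \<in> H1 w mu d \<Longrightarrow> direction x y \<bullet> \<alpha> = \<alpha> $ x $ y / d x y"
  using direction_props by auto

text \<open>The sum of the two representatives lies in \<open>H1\<close> and pairs to zero with
  every form there, hence with itself.\<close>

lemma direction_flip: "direction y x = - direction x y"
proof -
  let ?v = "direction y x + direction x y"
  have H: "?v \<in> H1 w mu d" by (intro subspace_add subspace_H1 direction_H1)
  have "?v \<bullet> ?v = 0"
    using H form_antisym[OF H1_one_form[OF H], of y x] d_sym[of x y]
    by (simp only: inner_add_left[of _ _ ?v] inner_direction)
  then show ?thesis by (simp add: eq_neg_iff_add_eq_0)
qed

lemma one_form_eq_0:
  assumes "\<alpha> \<in> one_forms w" "\<And>u v. nbr u v \<Longrightarrow> \<alpha> $ u $ v = 0"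
  shows "\<alpha> = 0"
  using assms one_form_zero[OF assms(1)] by (metis vec_eq_iff zero_index)

definition dirs :: "(real ^ 'a ^ 'a) set" where
  "dirs = {direction x y | x y. nbr x y}"

lemma finite_dirs: "finite dirs"
proof -
  have "dirs \<subseteq> (\<lambda>(x, y). direction x y) ` UNIV" by (auto simp: dirs_def)
  then show ?thesis by (rule finite_subset) simp
qed

lemma dirs_H1: "dirs \<subseteq> H1 w mu d"
  by (auto simp: dirs_def direction_H1)

lemma uminus_dirs: "uminus ` dirs = dirs"
proof -
  have "- s \<in> dirs" if "s \<in> dirs" for s
    using that unfolding dirs_def by (smt (verit, best) direction_flip mem_Collect_eq nbr_sym)
  then show ?thesis by (force simp: image_iff intro: bexI[of _ "- _"])
qed

end

section \<open>The slope polytope as seen from each vertex\<close>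

context nonneg_walk
begin

lemma max_slope_attained:
  assumes \<alpha>: "\<alpha> \<in> H1 w mu d"
  obtains y where "nbr x y" "\<And>u v. nbr u v \<Longrightarrow> \<alpha> $ u $ v / d u v \<le> \<alpha> $ x $ y / d x y"
proof -
  let ?R = "(\<lambda>(u, v). \<alpha> $ u $ v / d u v) ` {(u, v). nbr u v}"
  define c where "c = Max ?R"
  have le: "\<alpha> $ u $ v / d u v \<le> c" if "nbr u v" for u v
    unfolding c_def using that by (intro Max_ge) (auto intro!: image_eqI[of _ _ "(u, v)"])
  have "?R \<noteq> {}" using exists_nbr[of x] by auto
  then have "c \<in> ?R" unfolding c_def by (intro Max_in) auto
  then obtain x0 y0 where 0: "nbr x0 y0" "c = \<alpha> $ x0 $ y0 / d x0 y0" by auto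
  show ?thesis
  proof (cases "c > 0")
    case True
    have "slope_le \<alpha> c" unfolding slope_le_def
    proof (intro allI impI)
      fix u v assume uv: "nbr u v"
      show "\<alpha> $ u $ v \<le> c * d u v" using le[OF uv] d_pos(2)[OF uv] by (simp add: divide_le_eq)
    qed
    moreover have "\<alpha> $ x0 $ y0 = c * d x0 y0" unfolding 0(2) using nbr_neq[OF 0(1)] by simp
    ultimately obtain y where y: "nbr x y" "\<alpha> $ x $ y = c * d x y"
      using slope_attained_everywhere[OF \<alpha> _ True 0(1)] by blast
    have "\<alpha> $ x $ y / d x y = c" using y nbr_neq[OF y(1)] by simp
    then show ?thesis using that[OF y(1)] le by simp
  next
    case False
    \<comment> \<open>If no slope is positive, antisymmetry leaves only the zero form, and every
      neighbour attains the maximum.\<close>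
    have nonpos: "\<alpha> $ u $ v \<le> 0" if "nbr u v" for u v
    proof -
      have "\<alpha> $ u $ v / d u v \<le> 0" using le[OF that] False by linarith
      then show ?thesis using d_pos(2)[OF that] by (simp add: divide_le_0_iff)
    qed
    have "\<alpha> $ u $ v = 0" if "nbr u v" for u v
      using nonpos[OF that] nonpos[of v u] that nbr_sym[of u v] form_antisym[OF H1_one_form[OF \<alpha>], of u v]
      by linarith
    then have "\<alpha> = 0" using \<alpha> by (intro one_form_eq_0 H1_one_form)
    moreover obtain y where "nbr x y" using exists_nbr by blast
    ultimately show ?thesis using that by simp
  qed
qed

text \<open>A direction outside the hull at \<open>x\<close> could be separated from it. Projected
  to \<open>H1\<close> and negated, the separating vector is a form whose maximal slope is not
  attained at \<open>x\<close>, against \<open>max_slope_attained\<close>.\<close>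

lemma hull_dirs: "convex hull dirs = convex hull (direction x ` {y. nbr x y})"
proof
  show "convex hull (direction x ` {y. nbr x y}) \<subseteq> convex hull dirs"
    by (rule hull_mono) (auto simp: dirs_def)
  let ?K = "convex hull (direction x ` {y. nbr x y})"
  have "dirs \<subseteq> ?K"
  proof
    fix e assume e: "e \<in> dirs"
    show "e \<in> ?K"
    proof (rule ccontr)
      assume "e \<notin> ?K"
      moreover have "closed ?K" by (intro compact_imp_closed finite_imp_compact_convex_hull) simp
      ultimately obtain a b where ab: "a \<bullet> e < b" "\<And>z. z \<in> ?K \<Longrightarrow> a \<bullet> z > b"
        using separating_hyperplane_closed_point[of ?K e] by auto
      obtain v z where vz: "v \<in> span (H1 w mu d)" "\<And>u. u \<in> span (H1 w mu d) \<Longrightarrow> orthogonal z u" "a = v + z"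
        using orthogonal_subspace_decomp_exists by metis
      have av: "a \<bullet> u = v \<bullet> u" if "u \<in> H1 w mu d" for u
        using vz(2)[of u] that by (simp add: vz(3) inner_add_left orthogonal_def)
      have mv: "- v \<in> H1 w mu d" using vz(1) subspace_neg[OF subspace_H1] by auto
      obtain y where y: "nbr x y" "\<And>u u'. nbr u u' \<Longrightarrow> (-v) $ u $ u' / d u u' \<le> (-v) $ x $ y / d x y"
        using max_slope_attained[OF mv, of x] by blast
      obtain u u' where u: "e = direction u u'" "nbr u u'" using e by (auto simp: dirs_def)
      have "direction u u' \<bullet> (-v) \<le> direction x y \<bullet> (-v)"
        using y(2)[OF u(2)] by (simp only: inner_direction[OF mv])
      then have "v \<bullet> direction x y \<le> v \<bullet> e" using u by (simp add: inner_commute)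
      moreover have "a \<bullet> direction x y > b" using y(1) by (intro ab(2) hull_inc) auto
      ultimately show False using ab(1) av direction_H1 u(1) by fastforce
    qed
  qed
  then show "convex hull dirs \<subseteq> ?K" by (intro hull_minimal) auto
qed

end

text \<open>The degree is only bounded from above, which is what counting the generators of a torus
  gives; equality is derived in \<open>max_degree_eq\<close>.\<close>

locale sharp_walk = nonneg_walk +
  assumes degree_bound: "max_degree w \<le> 2 * betti1 w mu d"
begin

text \<open>The hull of the directions is the dual unit ball of the slope norm, seen from every vertex.
  It is symmetric, so its extreme points contain \<open>B \<union> -B\<close> for a basis \<open>B\<close>; there are at most
  \<open>2 * card B\<close> directions at a vertex, so nothing else is left.\<close>

lemma dirs_basis:
  obtains B where "independent B" "card B = betti1 w mu d" "dirs = B \<union> uminus ` B" "B \<inter> uminus ` B = {}"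
    "\<And>x. direction x ` {y. nbr x y} = dirs" "\<And>x. inj_on (direction x) {y. nbr x y}"
    "\<And>x. card {y. nbr x y} = 2 * betti1 w mu d"
proof -
  define K where "K = convex hull dirs"
  define E where "E = {e. e extreme_point_of K}"
  have E_sub: "E \<subseteq> direction x ` {y. nbr x y}" for x
    unfolding E_def K_def hull_dirs[of x] by (rule extreme_points_of_convex_hull)
  have KM: "K = convex hull E"
    unfolding E_def K_def
    by (intro Krein_Milman_Minkowski finite_imp_compact_convex_hull finite_dirs convex_convex_hull)
  have "uminus ` K = K"
    unfolding K_def using convex_hull_linear_image[of uminus dirs] uminus_dirs
    by (simp add: linear_uminus)
  then have E_sym: "- e \<in> E" if "e \<in> E" for e
    using that extreme_point_of_neg[of e K] by (simp add: E_def)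
  obtain B where B: "B \<subseteq> E" "independent B" "E \<subseteq> span B"
    by (rule maximal_independent_subset)
  have BH: "B \<subseteq> H1 w mu d" 
    using order_trans[OF B(1) E_sub[of undefined]] direction_H1 by auto
  \<comment> \<open>A form orthogonal to \<open>B\<close> would be orthogonal to every direction, so
    all its slopes would vanish.\<close>
  have "span B = H1 w mu d"
  proof (rule ccontr)
    assume "span B \<noteq> H1 w mu d"
    moreover have "span B \<subseteq> span (H1 w mu d)" using BH by (rule span_mono)
    ultimately have "span B \<subset> span (H1 w mu d)" by auto
    then obtain \<alpha> where \<alpha>: "\<alpha> \<noteq> 0" "\<alpha> \<in> H1 w mu d" "\<And>y. y \<in> span B \<Longrightarrow> orthogonal \<alpha> y"
      using orthogonal_to_subspace_exists_gen[of B "H1 w mu d"] by auto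
    have "dirs \<subseteq> convex hull E" unfolding KM[symmetric] K_def by (rule hull_subset)
    also have "\<dots> \<subseteq> span B" using B(3) by (intro hull_minimal) (auto intro: subspace_imp_convex)
    finally have "orthogonal \<alpha> (direction u v)" if "nbr u v" for u v
      using \<alpha>(3) that by (auto simp: dirs_def)
    then have "\<alpha> $ u $ v = 0" if "nbr u v" for u v
      using inner_direction[OF \<alpha>(2), of u v] that nbr_neq[OF that]
      by (auto simp: orthogonal_def inner_commute)
    then show False using \<alpha> one_form_eq_0 H1_one_form by blast
  qed
  then have cardB: "card B = betti1 w mu d"
    unfolding betti1_def using B(2) by (metis dim_eq_card_independent dim_span)
  have disj: "B \<inter> uminus ` B = {}"
  proof (rule ccontr)
    assume "B \<inter> uminus ` B \<noteq> {}"
    then obtain b b' where b: "b \<in> B" "b' \<in> B" "b = - b'" by auto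
    show False
    proof (cases "b = b'")
      case True
      then have "(2::real) *\<^sub>R b = 0" using b(3) by (metis scaleR_2 add.right_inverse)
      then have "b = 0" by simp
      then show False using b B(2) dependent_zero by blast
    next
      case False
      then have "b' \<in> B - {b}" using b by auto
      then have "- b' \<in> span (B - {b})" by (intro span_neg span_base)
      then have "b \<in> span (B - {b})" by (simp only: b(3)[symmetric])
      then show False using b(1) B(2) unfolding dependent_def by blast
    qed
  qed
  have finB: "finite B" using B(2) by (rule independent_imp_finite)
  have card2: "card (B \<union> uminus ` B) = 2 * betti1 w mu d"
    using finB disj cardB by (simp add: card_Un_disjoint card_image)
  have sub: "B \<union> uminus ` B \<subseteq> direction x ` {y. nbr x y}" for x
    using B(1) E_sym E_sub[of x] by blast
  have deg: "card {y. nbr x y} \<le> 2 * betti1 w mu d" for x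
  proof -
    have "card {y. nbr x y} = degree_of w x" unfolding degree_of_def by (simp add: nbr_sym[of _ x])
    also have "\<dots> \<le> max_degree w" unfolding max_degree_def by (intro Max_ge) auto
    finally show ?thesis using degree_bound by simp
  qed
  have card_im: "card (direction x ` {y. nbr x y}) \<le> card {y. nbr x y}" for x
    by (rule card_image_le) simp
  have eq: "direction x ` {y. nbr x y} = B \<union> uminus ` B" for x
    using card_subset_eq[OF _ sub[of x]] card2 deg[of x] card_im[of x] card_mono[OF _ sub[of x]] by force
  then have "dirs = B \<union> uminus ` B" unfolding dirs_def by blast
  moreover have "card {y. nbr x y} = 2 * betti1 w mu d" for x
    using card2 deg[of x] card_im[of x] by (simp add: eq)
  moreover have "inj_on (direction x) {y. nbr x y}" for x
    using calculation(2)[of x] eq[of x] card2 by (intro eq_card_imp_inj_on) auto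
  ultimately show ?thesis using that[of B] B(2) cardB disj eq by auto
qed

lemma dirs_at: "direction x ` {y. nbr x y} = dirs" "inj_on (direction x) {y. nbr x y}"
  by (rule dirs_basis; simp)+

lemma max_degree_eq: "max_degree w = 2 * betti1 w mu d"
proof -
  have "degree_of w x = 2 * betti1 w mu d" for x
    using dirs_basis unfolding degree_of_def nbr_sym[of _ x] by metis
  then have "range (degree_of w) = {2 * betti1 w mu d}" by auto
  then show ?thesis by (simp add: max_degree_def)
qed

lemma neg_dirs: "s \<in> dirs \<Longrightarrow> - s \<in> dirs"
  using uminus_dirs by blast

text \<open>A dual basis element: the component of \<open>s\<close> orthogonal to the span of the
  rest of \<open>B\<close>, rescaled. If instead \<open>- s\<close> lies in \<open>B\<close>, the
  sign is changed.\<close>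

lemma dual_form:
  assumes "s \<in> dirs"
  obtains A where "A \<in> H1 w mu d" "s \<bullet> A = 1" "\<And>t. t \<in> dirs \<Longrightarrow> t \<noteq> s \<Longrightarrow> t \<noteq> - s \<Longrightarrow> t \<bullet> A = 0"
proof -
  obtain B where B: "independent B" "dirs = B \<union> uminus ` B" using dirs_basis by metis
  have dualB: "\<exists>A. A \<in> H1 w mu d \<and> s \<bullet> A = 1 \<and> (\<forall>t\<in>B. t \<noteq> s \<longrightarrow> t \<bullet> A = 0)" if s: "s \<in> B" for s
  proof -
    obtain v z where vz: "v \<in> span (B - {s})" "\<And>u. u \<in> span (B - {s}) \<Longrightarrow> orthogonal z u" "s = v + z"
      using orthogonal_subspace_decomp_exists by metis
    have "s \<notin> span (B - {s})" using B(1) s by (auto simp: dependent_def)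
    then have "z \<noteq> 0" using vz by auto
    then have zz: "z \<bullet> z \<noteq> 0" by simp
    have "B \<subseteq> H1 w mu d" using B(2) dirs_H1 by auto
    then have "v \<in> H1 w mu d" using vz(1) span_mono[of "B - {s}" "H1 w mu d"] by auto
    moreover have "s \<in> H1 w mu d" using s \<open>B \<subseteq> H1 w mu d\<close> by auto
    moreover have "z = s - v" using vz(3) by simp
    ultimately have zH: "z \<in> H1 w mu d" using subspace_diff[OF subspace_H1] by blast
    have "v \<bullet> z = 0" using vz(2)[OF vz(1)] by (simp add: orthogonal_def inner_commute)
    then have "s \<bullet> z = z \<bullet> z" by (subst vz(3)) (simp add: inner_add_left)
    moreover have "t \<bullet> z = 0" if "t \<in> B" "t \<noteq> s" for t
      using vz(2)[of t] that by (auto simp: span_base orthogonal_def inner_commute)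
    ultimately show ?thesis using zz zH
      by (intro exI[of _ "(1 / (z \<bullet> z)) *\<^sub>R z"]) (auto intro: subspace_scale[OF subspace_H1])
  qed
  obtain b where b: "b \<in> B" "s = b \<or> s = - b" using assms B(2) by auto
  then obtain A where A: "A \<in> H1 w mu d" "b \<bullet> A = 1" "\<forall>t\<in>B. t \<noteq> b \<longrightarrow> t \<bullet> A = 0"
    using dualB by blast
  have A0: "t \<bullet> A = 0" if "t \<in> dirs" "t \<noteq> b" "t \<noteq> - b" for t
    using that A(3) by (auto simp: B(2))
  show ?thesis
  proof (cases "s = b")
    case True then show ?thesis using that[of A] A A0 by auto
  next
    case False
    then have "s = - b" using b by auto
    moreover have "- A \<in> H1 w mu d" using A(1) by (rule subspace_neg[OF subspace_H1])
    ultimately show ?thesis using that[of "- A"] A A0 by auto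
  qed
qed

lemma dirs_neq_neg: "s \<in> dirs \<Longrightarrow> s \<noteq> - s"
proof
  assume s: "s \<in> dirs" "s = - s"
  obtain A where "s \<bullet> A = 1" using dual_form[OF s(1)] by metis
  moreover have "s \<bullet> A = - (s \<bullet> A)" using s(2) by (metis inner_minus_left)
  ultimately show False by simp
qed

end

section \<open>Shifts in a direction\<close>

context sharp_walk
begin

text \<open>The permutation \<open>T\<^sub>s\<close>. The description is unique because the
  directions of the edges at \<open>x\<close> are pairwise distinct and exhaust
  \<open>dirs\<close>.\<close>

definition shift :: "real ^ 'a ^ 'a \<Rightarrow> 'a \<Rightarrow> 'a" where
  "shift s x = (THE y. nbr x y \<and> direction x y = s)"

lemma shift_props:
  assumes "s \<in> dirs"
  shows "nbr x (shift s x)" "direction x (shift s x) = s"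
proof -
  have "s \<in> direction x ` {y. nbr x y}" using assms dirs_at(1) by simp
  then have "\<exists>!y. nbr x y \<and> direction x y = s" using inj_onD[OF dirs_at(2)[of x]] by blast
  from theI'[OF this] show "nbr x (shift s x)" "direction x (shift s x) = s"
    by (simp_all add: shift_def)
qed

lemma shift_direction: "nbr x y \<Longrightarrow> shift (direction x y) x = y"
  unfolding shift_def using inj_onD[OF dirs_at(2)[of x]] by (intro the_equality) auto

lemma nbr_shift:
  assumes "nbr x y"
  obtains s where "s \<in> dirs" "y = shift s x"
proof (rule that)
  show "direction x y \<in> dirs" using assms by (auto simp: dirs_def)
  show "y = shift (direction x y) x" using shift_direction[OF assms] by simp
qed

lemma shift_inj: "s \<in> dirs \<Longrightarrow> t \<in> dirs \<Longrightarrow> shift s x = shift t x \<Longrightarrow> s = t"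
  using shift_props(2) by metis

lemma shift_neg [simp]: "s \<in> dirs \<Longrightarrow> shift (- s) (shift s x) = x"
  using shift_direction[of "shift s x" x] shift_props[of s x] nbr_sym direction_flip by metis

lemma shift_neg' [simp]: "s \<in> dirs \<Longrightarrow> shift s (shift (- s) x) = x"
  using shift_neg[of "- s" x] neg_dirs by simp

lemma form_shift:
  assumes "\<alpha> \<in> H1 w mu d" "s \<in> dirs"
  shows "\<alpha> $ x $ shift s x = (s \<bullet> \<alpha>) * d x (shift s x)"
  using inner_direction[OF assms(1), of x "shift s x"] shift_props[OF assms(2), of x] nbr_neq
  by (simp add: nonzero_divide_eq_eq)

lemma slope_le_1I:
  assumes "\<alpha> \<in> H1 w mu d" "\<And>q. q \<in> dirs \<Longrightarrow> q \<bullet> \<alpha> \<le> 1"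
  shows "slope_le \<alpha> 1"
  unfolding slope_le_def
proof (intro allI impI)
  fix u v assume "nbr u v"
  then obtain q where q: "q \<in> dirs" "v = shift q u" by (rule nbr_shift)
  then show "\<alpha> $ u $ v \<le> 1 * d u v"
    using form_shift[OF assms(1) q(1), of u] mult_right_mono[OF assms(2)[OF q(1)] d_nonneg[of u v]] by simp
qed

text \<open>\<open>coupling_parallel\<close> in terms of directions. The right-hand side does not
  depend on \<open>\<alpha>\<close>, so different admissible forms can be compared.\<close>

lemma transport_balance:
  assumes s: "s \<in> dirs" and t: "t \<in> dirs" and r: "r \<in> dirs" and y: "y = shift s x"
    and \<rho>: "coupling (p x) (p y) \<rho>" "transport_cost d \<rho> \<le> d x y" "\<rho> (shift t x) (shift r y) > 0"
    and \<alpha>: "\<alpha> \<in> H1 w mu d" "\<And>q. q \<in> dirs \<Longrightarrow> q \<bullet> \<alpha> \<le> 1" "s \<bullet> \<alpha> = 1"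
  shows "d x y + (r \<bullet> \<alpha>) * d y (shift r y) - (t \<bullet> \<alpha>) * d x (shift t x) = d (shift t x) (shift r y)"
proof -
  have xy: "nbr x y" using shift_props[OF s] y by simp
  have sl: "slope_le \<alpha> 1" using \<alpha>(1,2) by (rule slope_le_1I)
  have "\<alpha> $ x $ y = 1 * d x y" using form_shift[OF \<alpha>(1) s, of x] \<alpha>(3) y by simp
  from coupling_parallel[OF \<alpha>(1) sl _ \<rho>(1,2) xy this \<rho>(3)]
  show ?thesis
    using form_antisym[OF H1_one_form[OF \<alpha>(1)], of "shift t x" x]
    by (simp add: form_shift[OF \<alpha>(1)] t r \<open>\<alpha> $ x $ y = 1 * d x y\<close>)
qed

text \<open>Balance equations of dual forms restrict the direction \<open>r\<close> in which mass
  coming from direction \<open>t\<close> arrives. As lengths are positive, opposite signs are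
  excluded, and for \<open>t = s\<close> the choice \<open>r = - s\<close> would make a distance
  negative.\<close>

lemma transport_direction:
  assumes s: "s \<in> dirs" and t: "t \<in> dirs" and r: "r \<in> dirs" and y: "y = shift s x"
    and \<rho>: "coupling (p x) (p y) \<rho>" "transport_cost d \<rho> \<le> d x y" "\<rho> (shift t x) (shift r y) > 0"
  shows "t \<noteq> s \<Longrightarrow> t \<noteq> - s \<Longrightarrow>
      r = t \<and> d x (shift t x) = d y (shift t y) \<and> d (shift t x) (shift t y) = d x y"
    and "r \<noteq> s \<Longrightarrow> r \<noteq> - s \<Longrightarrow> t = r"
    and "t = s \<Longrightarrow> r = s"
proof -
  obtain A where A: "A \<in> H1 w mu d" "s \<bullet> A = 1" "\<And>t. t \<in> dirs \<Longrightarrow> t \<noteq> s \<Longrightarrow> t \<noteq> - s \<Longrightarrow> t \<bullet> A = 0"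
    using dual_form[OF s] by blast
  have Ale: "q \<bullet> A \<le> 1" if "q \<in> dirs" for q using A(2,3) that by (cases "q = s"; cases "q = - s") auto
  note balance = transport_balance[OF s t r y \<rho>]
  have dx: "d x (shift t x) > 0" and dy: "d y (shift r y) > 0"
    using shift_props t r d_pos(2) by blast+
  \<comment> \<open>Both \<open>A\<close> and \<open>A + A'\<close> have slopes at most 1 and slope
    1 in direction \<open>s\<close>; subtracting their balance equations isolates the contribution
    of \<open>A'\<close>.\<close>
  have key: "(r \<bullet> A') * d y (shift r y) = (t \<bullet> A') * d x (shift t x)"
    if q: "q \<in> dirs" "q \<noteq> s" "q \<noteq> - s" and A': "A' \<in> H1 w mu d" "q \<bullet> A' = 1"
      "\<And>t. t \<in> dirs \<Longrightarrow> t \<noteq> q \<Longrightarrow> t \<noteq> - q \<Longrightarrow> t \<bullet> A' = 0" for q A'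
  proof -
    have sA': "s \<bullet> A' = 0" using A'(3)[OF s] q by force
    have qA: "q \<bullet> A = 0" using A(3) q by blast
    have "u \<bullet> (A + A') \<le> 1" if u: "u \<in> dirs" for u
    proof -
      consider "u = s" | "u = - s" | "u = q" | "u = - q" | "u \<bullet> A = 0" "u \<bullet> A' = 0"
        using A(3)[OF u] A'(3)[OF u] by blast
      then show ?thesis using sA' qA A(2) A'(2) by cases (auto simp: inner_add_right)
    qed
    moreover have "A + A' \<in> H1 w mu d" using A(1) A'(1) by (rule subspace_add[OF subspace_H1])
    moreover have "s \<bullet> (A + A') = 1" using sA' A(2) by (simp add: inner_add_right)
    ultimately show ?thesis
      using balance[of "A + A'"] balance[OF A(1) Ale A(2)] by (simp add: inner_add_right distrib_right)
  qed
  show 1: "r = t \<and> d x (shift t x) = d y (shift t y) \<and> d (shift t x) (shift t y) = d x y"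
    if ts: "t \<noteq> s" "t \<noteq> - s"
  proof -
    obtain A' where A': "A' \<in> H1 w mu d" "t \<bullet> A' = 1" "\<And>u. u \<in> dirs \<Longrightarrow> u \<noteq> t \<Longrightarrow> u \<noteq> - t \<Longrightarrow> u \<bullet> A' = 0"
      using dual_form[OF t] by blast
    have k: "(r \<bullet> A') * d y (shift r y) = d x (shift t x)" using key[OF t ts A'] A'(2) by simp
    then have "r \<bullet> A' \<noteq> 0" using dx by auto
    then have "r = t \<or> r = - t" using A'(3)[OF r] by blast
    moreover have "r \<noteq> - t"
    proof
      assume "r = - t"
      then have "r \<bullet> A' = - 1" using A'(2) by simp
      then show False using k dx dy by simp
    qed
    ultimately have rt: "r = t" by blast
    then show ?thesis using k A'(2) balance[OF A(1) Ale A(2)] A(3)[OF t ts] by simp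
  qed
  show 2: "t = r" if rs: "r \<noteq> s" "r \<noteq> - s"
  proof -
    obtain A' where A': "A' \<in> H1 w mu d" "r \<bullet> A' = 1" "\<And>u. u \<in> dirs \<Longrightarrow> u \<noteq> r \<Longrightarrow> u \<noteq> - r \<Longrightarrow> u \<bullet> A' = 0"
      using dual_form[OF r] by blast
    have k: "d y (shift r y) = (t \<bullet> A') * d x (shift t x)" using key[OF r rs A'] A'(2) by simp
    then have "t \<bullet> A' \<noteq> 0" using dy by auto
    then have "t = r \<or> t = - r" using A'(3)[OF t] by blast
    moreover have "t \<noteq> - r"
    proof
      assume "t = - r"
      then have "t \<bullet> A' = - 1" using A'(2) by simp
      then show False using k dx dy by simp
    qed
    ultimately show ?thesis by blast
  qed
  show "r = s" if ts: "t = s"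
  proof (rule ccontr)
    assume rs: "r \<noteq> s"
    then have "r = - s" using 2 ts by blast
    then have "- d y (shift r y) = d (shift t x) (shift r y)"
      using balance[OF A(1) Ale A(2)] A(2) ts y by simp
    then show False using dy d_nonneg[of "shift t x" "shift r y"] by simp
  qed
qed

text \<open>By \<open>transport_direction\<close>, the row of \<open>shift t x\<close> and the
  column of \<open>shift t y\<close> are both concentrated on their common entry, so the two
  marginals agree.\<close>

lemma transverse:
  assumes s: "s \<in> dirs" and t: "t \<in> dirs" and ts: "t \<noteq> s" "t \<noteq> - s" and y: "y = shift s x"
  shows "p y (shift t y) = p x (shift t x)"
    and "d y (shift t y) = d x (shift t x)"
    and "\<exists>\<rho>. coupling (p x) (p y) \<rho> \<and> transport_cost d \<rho> \<le> d x y \<and> \<rho> (shift t x) (shift t y) > 0"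
    and "d (shift t x) (shift t y) = d x y"
proof -
  have xy: "nbr x y" using shift_props[OF s] y by simp
  obtain \<rho> where \<rho>: "coupling (p x) (p y) \<rho>" "transport_cost d \<rho> \<le> d x y"
    using good_coupling[OF xy] by blast
  note dir = transport_direction[OF s _ _ y \<rho>]
  have row: "\<rho> (shift t x) (shift t y) = p x (shift t x)"
  proof (rule coupling_row_concentrated[OF \<rho>(1)], rule ccontr)
    fix v assume v: "v \<noteq> shift t y" "\<rho> (shift t x) v \<noteq> 0"
    then have pos: "\<rho> (shift t x) v > 0" using coupling_zero[OF \<rho>(1)] by blast
    obtain r where "r \<in> dirs" "v = shift r y" using nbr_shift[OF coupling_support(2)[OF \<rho>(1) pos]] .
    then show False using dir(1)[OF t _ _ ts, of r] pos v(1) by blast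
  qed
  have col: "\<rho> (shift t x) (shift t y) = p y (shift t y)"
  proof (rule coupling_column_concentrated[OF \<rho>(1)], rule ccontr)
    fix u assume u: "u \<noteq> shift t x" "\<rho> u (shift t y) \<noteq> 0"
    then have pos: "\<rho> u (shift t y) > 0" using coupling_zero[OF \<rho>(1)] by blast
    obtain r where "r \<in> dirs" "u = shift r x" using nbr_shift[OF coupling_support(1)[OF \<rho>(1) pos]] .
    then show False using dir(2)[OF _ t _ ts, of r] pos u(1) by blast
  qed
  have pos: "\<rho> (shift t x) (shift t y) > 0" using row shift_props(1)[OF t] p_pos_iff by simp
  show "p y (shift t y) = p x (shift t x)" using row col by simp
  show "\<exists>\<rho>. coupling (p x) (p y) \<rho> \<and> transport_cost d \<rho> \<le> d x y \<and> \<rho> (shift t x) (shift t y) > 0"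
    using \<rho> pos by blast
  show "d y (shift t y) = d x (shift t x)" "d (shift t x) (shift t y) = d x y"
    using dir(1)[OF t t pos ts] by simp_all
qed

text \<open>For transverse directions, tightness of the transport from \<open>u\<close> to
  \<open>v\<close> gives an edge of slope 1 that leaves \<open>u\<close> towards \<open>v\<close>.
  Its direction can only be \<open>s\<close>, and its length already equals \<open>d u v\<close>, so
  it ends at \<open>v\<close>.\<close>

lemma shift_commute:
  assumes s: "s \<in> dirs" and t: "t \<in> dirs"
  shows "shift s (shift t x) = shift t (shift s x)"
proof (cases "t = s \<or> t = - s")
  case True
  then show ?thesis using s by auto
next
  case False
  then have ts: "t \<noteq> s" "t \<noteq> - s" and st: "s \<noteq> t" "s \<noteq> - t" by auto
  define y u v where "y = shift s x" and "u = shift t x" and "v = shift t y"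
  obtain A where A: "A \<in> H1 w mu d" "s \<bullet> A = 1" "\<And>t. t \<in> dirs \<Longrightarrow> t \<noteq> s \<Longrightarrow> t \<noteq> - s \<Longrightarrow> t \<bullet> A = 0"
    using dual_form[OF s] by blast
  have "q \<bullet> A \<le> 1" if "q \<in> dirs" for q using A(2,3) that by (cases "q = s"; cases "q = - s") auto
  then have sl: "slope_le A 1" using A(1) by (intro slope_le_1I)
  have nb: "nbr x y" "nbr x u" "nbr u x" "nbr y v"
    using shift_props(1) s t nbr_sym by (auto simp: y_def u_def v_def)
  have Axy: "A $ x $ y = 1 * d x y" using form_shift[OF A(1) s, of x] A(2) by (simp add: y_def)
  obtain \<rho> where "coupling (p x) (p y) \<rho>" "transport_cost d \<rho> \<le> d x y" "\<rho> u v > 0"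
    using transverse(3)[OF s t ts y_def] by (auto simp: u_def v_def)
  then have eq: "A $ u $ x + A $ x $ y + A $ y $ v = 1 * d u v"
    using coupling_parallel[OF A(1) sl _ _ _ nb(1) Axy] by simp
  have duv: "d u v = d x y" using transverse(4)[OF s t ts y_def] by (simp add: u_def v_def)
  then have "u \<noteq> v" using d_pos(2)[OF nb(1)] by auto
  then obtain g where g: "nbr u g" "A $ u $ g = 1 * d u g" "d u v = d u g + d g v"
    using three_steps_eq[OF H1_closed[OF A(1)] sl nb(3,1,4) _ eq] by blast
  obtain q where q: "q \<in> dirs" "g = shift q u" using nbr_shift[OF g(1)] .
  have "q \<bullet> A = 1" using form_shift[OF A(1) q(1), of u] g(2) nbr_neq[OF g(1)] q(2) by simp
  then have "q = s" using A(2) A(3)[OF q(1)] by force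
  then have "d u g = d x y"
    using transverse(2)[OF t s st u_def] q(2) by (simp add: y_def)
  then have "g = v" using g(3) duv by simp
  then show ?thesis using q(2) \<open>q = s\<close> by (simp add: u_def v_def y_def)
qed

section \<open>Invariance of \<open>p\<close>, \<open>d\<close> and \<open>mu\<close> under
  shifts\<close>

lemma bij_shift: "s \<in> dirs \<Longrightarrow> bij (shift s)"
  by (rule bij_betw_byWitness[of _ "shift (- s)"]) auto

text \<open>Mass in direction \<open>s\<close> stays in direction \<open>s\<close>, so the
  probability cannot decrease along \<open>shift s\<close>. As \<open>shift s\<close> permutes the
  finite vertex set, the sums over all vertices agree and every inequality is an equality.\<close>

lemma p_parallel:
  assumes s: "s \<in> dirs"
  shows "p (shift s x) (shift s (shift s x)) = p x (shift s x)"
proof -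
  have le: "p x (shift s x) \<le> p (shift s x) (shift s (shift s x))" for x
  proof -
    define y where "y = shift s x"
    have xy: "nbr x y" using shift_props[OF s] y_def by simp
    obtain \<rho> where \<rho>: "coupling (p x) (p y) \<rho>" "transport_cost d \<rho> \<le> d x y"
      using good_coupling[OF xy] by blast
    have "\<rho> (shift s x) (shift s y) = p x (shift s x)"
    proof (rule coupling_row_concentrated[OF \<rho>(1)], rule ccontr)
      fix v assume v: "v \<noteq> shift s y" "\<rho> (shift s x) v \<noteq> 0"
      then have pos: "\<rho> (shift s x) v > 0" using coupling_zero[OF \<rho>(1)] by blast
      obtain r where "r \<in> dirs" "v = shift r y" using nbr_shift[OF coupling_support(2)[OF \<rho>(1) pos]] .
      then show False using transport_direction(3)[OF s s _ y_def \<rho>, of r] pos v(1) by blast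
    qed
    then show ?thesis using coupling_le_marginals(2)[OF \<rho>(1), of "shift s x" "shift s y"] by (simp add: y_def)
  qed
  have "(\<Sum>x\<in>UNIV. p x (shift s x)) = (\<Sum>x\<in>UNIV. p (shift s x) (shift s (shift s x)))"
    using sum.reindex_bij_betw[OF bij_shift[OF s], of "\<lambda>x. p x (shift s x)"] by simp
  from sum_mono_inv[OF this le, of x] show ?thesis by simp
qed

lemma p_shift_const:
  assumes r: "r \<in> dirs"
  shows "p x (shift r x) = p z (shift r z)"
proof (induction x rule: nbr_induct[of _ z])
  case (step x y)
  then obtain s where s: "s \<in> dirs" "y = shift s x" using nbr_shift by blast
  consider "r = s" | "r = - s" | "r \<noteq> s" "r \<noteq> - s" by blast
  then have "p y (shift r y) = p x (shift r x)"
  proof cases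
    case 1 then show ?thesis using p_parallel[OF s(1)] s by simp
  next
    case 2 then show ?thesis using p_parallel[OF r, of y] s by simp
  next
    case 3 then show ?thesis using transverse(1)[OF s(1) r 3 s(2)] by simp
  qed
  then show ?case using step by simp
qed simp

text \<open>For the form dual to \<open>s\<close>, the vanishing of \<open>codiff\<close> at
  \<open>x\<close> involves only the directions \<open>s\<close> and \<open>- s\<close>.\<close>

lemma codiff_balance:
  assumes s: "s \<in> dirs"
  shows "p x (shift s x) * d x (shift s x) = p x (shift (- s) x) * d x (shift (- s) x)"
proof -
  obtain A where A: "A \<in> H1 w mu d" "s \<bullet> A = 1" "\<And>t. t \<in> dirs \<Longrightarrow> t \<noteq> s \<Longrightarrow> t \<noteq> - s \<Longrightarrow> t \<bullet> A = 0"
    using dual_form[OF s] by blast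
  have "0 = (\<Sum>y\<in>UNIV. p x y * A $ x $ y)" using H1_codiff[OF A(1)] by simp
  also have "\<dots> = (\<Sum>y\<in>{shift s x, shift (- s) x}. p x y * A $ x $ y)"
  proof (intro sum.mono_neutral_right ballI)
    fix y assume "y \<in> UNIV - {shift s x, shift (- s) x}"
    then have y: "y \<noteq> shift s x" "y \<noteq> shift (- s) x" by auto
    show "p x y * A $ x $ y = 0"
    proof (cases "nbr x y")
      case True
      then obtain t where t: "t \<in> dirs" "y = shift t x" using nbr_shift by blast
      then have "t \<bullet> A = 0" using A(3)[OF t(1)] y by blast
      then show ?thesis using form_shift[OF A(1) t(1), of x] t(2) by simp
    qed (simp add: p_eq_0)
  qed auto
  also have "(\<Sum>y\<in>{shift s x, shift (- s) x}. p x y * A $ x $ y)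
      = p x (shift s x) * d x (shift s x) - p x (shift (- s) x) * d x (shift (- s) x)"
  proof -
    have "shift s x \<noteq> shift (- s) x"
      using shift_inj[OF s neg_dirs[OF s], of x] dirs_neq_neg[OF s] by blast
    then show ?thesis
      using form_shift[OF A(1) s, of x] form_shift[OF A(1) neg_dirs[OF s], of x] A(2) by simp
  qed
  finally show ?thesis by simp
qed

text \<open>The probabilities do not depend on the vertex. Summing \<open>codiff_balance\<close>
  over all vertices, where \<open>shift (- s)\<close> only permutes the lengths, shows that the two
  probabilities agree; then the lengths agree pointwise.\<close>

lemma shift_symmetric:
  assumes s: "s \<in> dirs"
  shows "p x (shift (- s) x) = p x (shift s x)" "d x (shift (- s) x) = d x (shift s x)"
proof -
  note ns = neg_dirs[OF s]
  define D q q' where "D = (\<lambda>x. d x (shift s x))" and "q = p x (shift s x)" and "q' = p x (shift (- s) x)"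
  have D: "d x (shift (- s) x) = D (shift (- s) x)" for x using s by (simp add: D_def d_sym)
  have bal: "q * D x = q' * D (shift (- s) x)" for x
    using codiff_balance[OF s, of x] p_shift_const[OF s, of x] p_shift_const[OF ns, of x]
    unfolding q_def q'_def D[symmetric] by (metis D_def)
  have "q * (\<Sum>x\<in>UNIV. D x) = q' * (\<Sum>x\<in>UNIV. D (shift (- s) x))"
    using bal by (simp add: sum_distrib_left)
  also have "(\<Sum>x\<in>UNIV. D (shift (- s) x)) = (\<Sum>x\<in>UNIV. D x)"
    using sum.reindex_bij_betw[OF bij_shift[OF ns]] .
  finally have "q * (\<Sum>x\<in>UNIV. D x) = q' * (\<Sum>x\<in>UNIV. D x)" .
  moreover have "(\<Sum>x\<in>UNIV. D x) > 0"
    unfolding D_def by (intro sum_pos d_pos(2) shift_props(1) s) auto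
  ultimately have qq: "q = q'" by simp
  then show "p x (shift (- s) x) = p x (shift s x)" by (simp add: q_def q'_def)
  have "q > 0" unfolding q_def using shift_props(1)[OF s] p_pos_iff by simp
  then show "d x (shift (- s) x) = d x (shift s x)" using bal[of x] qq by (simp add: D D_def)
qed

lemma d_shift_const:
  assumes r: "r \<in> dirs"
  shows "d x (shift r x) = d z (shift r z)"
proof (induction x rule: nbr_induct[of _ z])
  case (step x y)
  then obtain s where s: "s \<in> dirs" "y = shift s x" using nbr_shift by blast
  consider "r = s" | "r = - s" | "r \<noteq> s" "r \<noteq> - s" by blast
  then have "d y (shift r y) = d x (shift r x)"
  proof cases
    case 1 then show ?thesis using shift_symmetric(2)[OF s(1), of y] s by (simp add: d_sym)
  next
    case 2 then show ?thesis using shift_symmetric(2)[OF s(1), of x] s by (simp add: d_sym)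
  next
    case 3 then show ?thesis using transverse(2)[OF s(1) r 3 s(2)] by simp
  qed
  then show ?case using step by simp
qed simp

text \<open>The transition probabilities in both directions of an edge agree, and \<open>w\<close>
  is symmetric.\<close>

lemma mu_const: "mu x = mu z"
proof (induction x rule: nbr_induct[of _ z])
  case (step x y)
  then obtain s where s: "s \<in> dirs" "y = shift s x" using nbr_shift by blast
  have "p y x = p x y"
    using p_shift_const[OF neg_dirs[OF s(1)], of y x] shift_symmetric(1)[OF s(1), of x] s by simp
  moreover have "p x y > 0" using step p_pos_iff by simp
  ultimately have "mu y = mu x"
    using w_sym[of x y] mu_pos[of x] mu_pos[of y] by (auto simp: trans_prob_def field_simps)
  then show ?case using step by simp
qed simp

end

section \<open>Curvature and optimal transport\<close>

text \<open>Couplings form a compact set of matrices and the cost is continuous. Attainment matters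
  because \<open>nonneg_walk\<close> asks for an actual coupling and not for an infimum.\<close>

lemma wasserstein_attained:
  fixes d :: "'a::finite \<Rightarrow> 'a \<Rightarrow> real"
  assumes "coupling m m' \<rho>\<^sub>0"
  obtains \<rho> where "coupling m m' \<rho>" "transport_cost d \<rho> = wasserstein d m m'"
proof -
  define S where "S = {\<rho> :: real ^ 'a ^ 'a. coupling m m' (\<lambda>u v. \<rho> $ u $ v)}"
  have "closed S"
    unfolding S_def coupling_def
    by (intro closed_Collect_conj closed_Collect_all closed_Collect_le closed_Collect_eq continuous_intros)
  moreover have "bounded S"
  proof (rule boundedI)
    fix \<rho> assume \<rho>: "\<rho> \<in> S"
    have "norm \<rho> \<le> (\<Sum>u\<in>UNIV. norm (\<rho> $ u))"
      unfolding norm_vec_def by (rule L2_set_le_sum) simp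
    also have "\<dots> \<le> (\<Sum>u\<in>UNIV. \<Sum>v\<in>UNIV. \<bar>\<rho> $ u $ v\<bar>)"
      by (intro sum_mono norm_le_l1_cart)
    also have "\<dots> = (\<Sum>u\<in>UNIV. m u)" using \<rho> by (simp add: S_def coupling_def)
    finally show "norm \<rho> \<le> (\<Sum>u\<in>UNIV. m u)" .
  qed
  ultimately have "compact S" by (simp add: compact_eq_bounded_closed)
  moreover have "(\<chi> u v. \<rho>\<^sub>0 u v) \<in> S" using assms by (simp add: S_def coupling_def)
  then have "S \<noteq> {}" by auto
  moreover have "continuous_on S (\<lambda>\<rho>. transport_cost d (\<lambda>u v. \<rho> $ u $ v))"
    by (intro continuous_intros)
  ultimately obtain \<rho> where \<rho>: "\<rho> \<in> S"
    and min: "\<And>\<rho>'. \<rho>' \<in> S \<Longrightarrow> transport_cost d (\<lambda>u v. \<rho> $ u $ v) \<le> transport_cost d (\<lambda>u v. \<rho>' $ u $ v)"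
    using continuous_attains_inf[of S] by blast
  have "wasserstein d m m' = transport_cost d (\<lambda>u v. \<rho> $ u $ v)"
    unfolding wasserstein_def
  proof (rule cInf_eq_minimum)
    show "transport_cost d (\<lambda>u v. \<rho> $ u $ v) \<in> {transport_cost d \<rho> |\<rho>. coupling m m' \<rho>}"
      using \<rho> by (auto simp: S_def)
    fix c assume "c \<in> {transport_cost d \<rho> |\<rho>. coupling m m' \<rho>}"
    then obtain \<rho>' where "coupling m m' \<rho>'" "c = transport_cost d \<rho>'" by auto
    then show "transport_cost d (\<lambda>u v. \<rho> $ u $ v) \<le> c"
      using min[of "\<chi> u v. \<rho>' u v"] by (simp add: S_def coupling_def)
  qed
  then show ?thesis using that[of "\<lambda>u v. \<rho> $ u $ v"] \<rho> by (simp add: S_def)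
qed

context markov_graph
begin

lemma wasserstein_le:
  assumes "coupling m m' \<rho>"
  shows "wasserstein d m m' \<le> transport_cost d \<rho>"
  unfolding wasserstein_def
proof (rule cInf_lower)
  show "bdd_below {transport_cost d \<rho> |\<rho>. coupling m m' \<rho>}"
    by (rule bdd_belowI[of _ 0]) (auto simp: coupling_def intro!: sum_nonneg mult_nonneg_nonneg d_nonneg)
qed (use assms in auto)

lemma nonneg_walkI:
  assumes "\<And>x y. nbr x y \<Longrightarrow> idle_curvature w mu d 1 x y \<ge> 0"
  shows "nonneg_walk w mu d"
proof unfold_locales
  fix x y assume xy: "nbr x y"
  \<comment> \<open>The product coupling shows that couplings exist at all.\<close>
  have "coupling (p x) (p y) (\<lambda>u v. p x u * p y v)"
    using sum_p p_nonneg by (simp add: coupling_def flip: sum_distrib_left sum_distrib_right)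
  then obtain \<rho> where \<rho>: "coupling (p x) (p y) \<rho>" "transport_cost d \<rho> = wasserstein d (p x) (p y)"
    by (rule wasserstein_attained)
  then show "\<exists>\<rho>. coupling (p x) (p y) \<rho> \<and> transport_cost d \<rho> \<le> d x y"
    using assms[OF xy] d_pos(2)[OF xy] by (auto simp: idle_curvature_def lazy_walk_1 field_simps)
qed

lemma laplacian_eq: "laplacian w mu f x = (\<Sum>y\<in>UNIV. p x y * f y) - f x"
  using sum_p[of x] by (simp add: laplacian_def right_diff_distrib sum_subtractf flip: sum_distrib_right)

lemma Sup_grad_eq_1_imp_le:
  assumes "Sup {\<bar>grad d u v f\<bar> | u v. u \<noteq> v} = 1"
  shows "\<bar>f u - f v\<bar> \<le> d u v"
proof (cases "u = v")
  case False
  have "{\<bar>grad d u v f\<bar> | u v. u \<noteq> v} \<subseteq> (\<lambda>(u, v). \<bar>grad d u v f\<bar>) ` UNIV" by auto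
  then have "finite {\<bar>grad d u v f\<bar> | u v. u \<noteq> v}" by (rule finite_subset) simp
  then have "\<bar>grad d u v f\<bar> \<le> 1"
    unfolding assms[symmetric] using False by (intro cSup_upper bdd_above_finite) auto
  then show ?thesis using d_pos(1)[OF False] by (simp add: grad_def field_simps)
qed simp

text \<open>A witness that the set in \<open>ollivier_curvature\<close> is nonempty; otherwise a
  lower bound on its elements would say nothing about its \<open>Inf\<close>.\<close>

lemma distance_function_admissible:
  assumes "x \<noteq> y"
  shows "grad d y x (d x) = 1" "Sup {\<bar>grad d u v (d x)\<bar> | u v. u \<noteq> v} = 1"
proof -
  show g: "grad d y x (d x) = 1" using assms by (simp add: grad_def d_sym)
  have "\<bar>grad d u v (d x)\<bar> \<le> 1" if "u \<noteq> v" for u v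
  proof -
    have "\<bar>d x u - d x v\<bar> \<le> d u v"
      using triangle[of x u v] triangle[of x v u] d_sym[of u v] by linarith
    then show ?thesis using d_pos(1)[OF that] by (simp add: grad_def)
  qed
  moreover have "1 \<in> {\<bar>grad d u v (d x)\<bar> | u v. u \<noteq> v}"
    by (rule CollectI, rule exI[of _ y], rule exI[of _ x]) (use g assms in auto)
  ultimately show "Sup {\<bar>grad d u v (d x)\<bar> | u v. u \<noteq> v} = 1"
    by (intro cSup_eq_maximum) auto
qed

end

context nonneg_walk
begin

text \<open>Easy half of Kantorovich duality: integrating a 1-Lipschitz \<open>f\<close> against a
  coupling of cost at most \<open>d x y\<close> bounds the difference of its means.\<close>

lemma nonneg_curvature: "nonneg_ollivier_curvature w mu d"
  unfolding nonneg_ollivier_curvature_def ollivier_curvature_def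
proof (intro allI impI cInf_greatest)
  fix x y assume xy: "nbr x y"
  show "{grad d x y (laplacian w mu f) |f. grad d y x f = 1 \<and> Sup {\<bar>grad d u v f\<bar> |u v. u \<noteq> v} = 1} \<noteq> {}"
    using distance_function_admissible[OF nbr_neq[OF xy]] by blast
  fix c assume "c \<in> {grad d x y (laplacian w mu f) |f. grad d y x f = 1 \<and> Sup {\<bar>grad d u v f\<bar> |u v. u \<noteq> v} = 1}"
  then obtain f where c: "c = grad d x y (laplacian w mu f)" and f: "grad d y x f = 1"
    and S: "Sup {\<bar>grad d u v f\<bar> |u v. u \<noteq> v} = 1" by auto
  note Lip = Sup_grad_eq_1_imp_le[OF S]
  obtain \<rho> where \<rho>: "coupling (p x) (p y) \<rho>" "transport_cost d \<rho> \<le> d x y"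
    using good_coupling[OF xy] by blast
  have "(\<Sum>v\<in>UNIV. p y v * f v) - (\<Sum>u\<in>UNIV. p x u * f u) = (\<Sum>u\<in>UNIV. \<Sum>v\<in>UNIV. \<rho> u v * (- f u + f v))"
    unfolding coupling_sum_add[OF \<rho>(1)] by (simp add: sum_negf)
  also have "\<dots> \<le> transport_cost d \<rho>"
  proof (intro sum_mono mult_left_mono)
    show "- f u + f v \<le> d u v" for u v using Lip[of u v] by linarith
  qed (use \<rho>(1) in \<open>simp add: coupling_def\<close>)
  also have "\<dots> \<le> f y - f x" using f \<rho>(2) nbr_neq[OF xy] by (auto simp: grad_def d_sym field_simps)
  finally have "laplacian w mu f y \<le> laplacian w mu f x" by (simp add: laplacian_eq)
  then show "0 \<le> c" using d_nonneg by (simp add: c grad_def)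
qed

text \<open>Mix the coupling of \<open>p x\<close> and \<open>p y\<close> with the unit mass at the
  pair \<open>x\<close>, \<open>y\<close>, with weights \<open>\<epsilon>\<close> and
  \<open>1 - \<epsilon>\<close>.\<close>

lemma lazy_coupling:
  assumes xy: "nbr x y" and \<epsilon>: "\<epsilon> \<in> {0..1}"
  obtains \<rho> where "coupling (lazy_walk w mu \<epsilon> x) (lazy_walk w mu \<epsilon> y) \<rho>" "transport_cost d \<rho> \<le> d x y"
proof -
  obtain \<rho> where \<rho>: "coupling (p x) (p y) \<rho>" "transport_cost d \<rho> \<le> d x y"
    using good_coupling[OF xy] by blast
  define \<rho>' where "\<rho>' u v = \<epsilon> * \<rho> u v + (if u = x then if v = y then 1 - \<epsilon> else 0 else 0)" for u v
  have lazy: "lazy_walk w mu \<epsilon> x u = \<epsilon> * p x u + (if u = x then 1 - \<epsilon> else 0)" for x u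
    by (simp add: lazy_walk_def p_eq_0)
  have row: "(\<Sum>v\<in>UNIV. \<rho>' u v) = lazy_walk w mu \<epsilon> x u" for u
    using \<rho>(1) by (simp add: \<rho>'_def lazy coupling_def sum.distrib flip: sum_distrib_left)
  have col: "(\<Sum>u\<in>UNIV. \<rho>' u v) = lazy_walk w mu \<epsilon> y v" for v
    using \<rho>(1) by (simp add: \<rho>'_def lazy coupling_def sum.distrib flip: sum_distrib_left)
  have "coupling (lazy_walk w mu \<epsilon> x) (lazy_walk w mu \<epsilon> y) \<rho>'"
    unfolding coupling_def using row col \<rho>(1) \<epsilon> by (auto simp: \<rho>'_def coupling_def)
  moreover have "transport_cost d \<rho>' = \<epsilon> * transport_cost d \<rho> + (1 - \<epsilon>) * d x y"
  proof -
    have "(\<Sum>v\<in>UNIV. \<rho>' u v * d u v)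
        = \<epsilon> * (\<Sum>v\<in>UNIV. \<rho> u v * d u v) + (if u = x then (1 - \<epsilon>) * d x y else 0)" for u
    proof -
      have "\<rho>' u v * d u v = \<epsilon> * (\<rho> u v * d u v) + (if v = y then if u = x then (1 - \<epsilon>) * d x y else 0 else 0)" for v
        by (simp add: \<rho>'_def distrib_right)
      then show ?thesis by (simp add: sum.distrib sum_distrib_left)
    qed
    then show ?thesis by (simp add: sum.distrib sum_distrib_left)
  qed
  then have "transport_cost d \<rho>' \<le> d x y"
    using mult_left_mono[OF \<rho>(2), of \<epsilon>] \<epsilon> by (simp add: algebra_simps)
  ultimately show ?thesis using that by blast
qed

end

context sharp_walk
begin

text \<open>\<open>lazy_coupling\<close> gives the upper bound; the form dual to the direction of
  the edge, used as a potential, gives the lower one.\<close>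

lemma wasserstein_lazy:
  assumes xy: "nbr x y" and \<epsilon>: "\<epsilon> \<in> {0..1}"
  shows "wasserstein d (lazy_walk w mu \<epsilon> x) (lazy_walk w mu \<epsilon> y) = d x y"
proof -
  obtain \<rho> where \<rho>: "coupling (lazy_walk w mu \<epsilon> x) (lazy_walk w mu \<epsilon> y) \<rho>" "transport_cost d \<rho> \<le> d x y"
    using lazy_coupling[OF xy \<epsilon>] .
  obtain s where s: "s \<in> dirs" "y = shift s x" using nbr_shift[OF xy] .
  obtain A where A: "A \<in> H1 w mu d" "s \<bullet> A = 1" "\<And>t. t \<in> dirs \<Longrightarrow> t \<noteq> s \<Longrightarrow> t \<noteq> - s \<Longrightarrow> t \<bullet> A = 0"
    using dual_form[OF s(1)] by blast
  have "q \<bullet> A \<le> 1" if "q \<in> dirs" for q using A(2,3) that by (cases "q = s"; cases "q = - s") auto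
  then have sl: "slope_le A 1" using A(1) by (intro slope_le_1I)
  have Axy: "A $ x $ y = d x y" using form_shift[OF A(1) s(1), of x] A(2) s(2) by simp
  have "d x y \<le> wasserstein d (lazy_walk w mu \<epsilon> x) (lazy_walk w mu \<epsilon> y)"
    unfolding wasserstein_def
    by (rule cInf_greatest) (use \<rho>(1) lazy_transport_ge[OF A(1) sl xy Axy] in auto)
  then show ?thesis using wasserstein_le[OF \<rho>(1)] \<rho>(2) by simp
qed

lemma bone_idle: "bone_idle w mu d"
  unfolding bone_idle_def idle_curvature_def
  using total_weight wasserstein_lazy nbr_neq by auto

lemma sharp: "ollivier_betti_sharp w mu d"
  by (simp add: ollivier_betti_sharp_def nonneg_curvature max_degree_eq)

end

section \<open>The group generated by the shifts\<close>

context sharp_walk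
begin

text \<open>The group generated by the shifts; inverses are included because \<open>dirs\<close> is
  closed under negation.\<close>

inductive_set moves :: "('a \<Rightarrow> 'a) set" where
  id: "id \<in> moves"
| step: "s \<in> dirs \<Longrightarrow> g \<in> moves \<Longrightarrow> shift s \<circ> g \<in> moves"

lemma moves_shift: "g \<in> moves \<Longrightarrow> s \<in> dirs \<Longrightarrow> g (shift s x) = shift s (g x)"
  by (induction arbitrary: x rule: moves.induct) (auto simp: shift_commute)

lemma moves_commute: "g \<in> moves \<Longrightarrow> h \<in> moves \<Longrightarrow> g (h x) = h (g x)"
  by (induction arbitrary: x rule: moves.induct) (auto simp: moves_shift)

lemma moves_comp: "g \<in> moves \<Longrightarrow> h \<in> moves \<Longrightarrow> g \<circ> h \<in> moves"
  by (induction rule: moves.induct) (auto simp: comp_assoc intro: moves.intros)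

lemma shift_moves: "s \<in> dirs \<Longrightarrow> shift s \<in> moves"
  using moves.step[OF _ moves.id] by simp

lemma moves_surj: "g \<in> moves \<Longrightarrow> \<exists>x. g x = y"
proof (induction arbitrary: y rule: moves.induct)
  case (step s g)
  then show ?case using shift_neg'[of s y] by (metis comp_apply)
qed auto

lemma moves_transitive: "\<exists>g\<in>moves. g x = y"
proof (induction y rule: nbr_induct[of _ x])
  case base
  show ?case by (rule bexI[OF _ moves.id]) simp
next
  case (step y z)
  then obtain s g where "s \<in> dirs" "z = shift s y" "g \<in> moves" "g x = y" using nbr_shift by metis
  then show ?case by (intro bexI[of _ "shift s \<circ> g"] moves.step) auto
qed

text \<open>A commutative transitive action is free: agreement at \<open>x\<close> is carried to
  every \<open>k x\<close> by commuting with \<open>k\<close>.\<close>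

lemma moves_free:
  assumes "g \<in> moves" "h \<in> moves" "g x = h x"
  shows "g = h"
proof
  fix y
  obtain k where k: "k \<in> moves" "y = k x" using moves_transitive by metis
  show "g y = h y"
    using moves_commute[OF assms(1) k(1), of x] moves_commute[OF assms(2) k(1), of x] assms(3) k(2) by simp
qed

text \<open>An arbitrary base point; \<open>undefined\<close> merely names some vertex.\<close>

abbreviation origin :: 'a where "origin \<equiv> undefined"

definition move :: "'a \<Rightarrow> 'a \<Rightarrow> 'a" where
  "move x = (SOME g. g \<in> moves \<and> g origin = x)"

lemma move_props: "move x \<in> moves" "move x origin = x"
  using someI_ex[of "\<lambda>g. g \<in> moves \<and> g origin = x"] moves_transitive[of origin x]
  unfolding move_def by blast+

lemma move_eq: "g \<in> moves \<Longrightarrow> move (g origin) = g"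
  using moves_free[OF move_props(1)] move_props(2) by blast

text \<open>The simply transitive action identifies \<open>x\<close> with the move that takes
  \<open>origin\<close> to \<open>x\<close>; composition of moves is carried over to the
  vertices.\<close>

definition torus :: "'a monoid" where
  "torus = \<lparr>carrier = UNIV, monoid.mult = move, one = origin\<rparr>"

lemma torus_simps [simp]: "carrier torus = UNIV" "x \<otimes>\<^bsub>torus\<^esub> y = move x y" "\<one>\<^bsub>torus\<^esub> = origin"
  by (simp_all add: torus_def)

lemma move_move: "move (move x y) = move x \<circ> move y"
  using move_eq[OF moves_comp[OF move_props(1) move_props(1)], of x y] move_props(2) by simp

lemma move_commute: "move x y = move y x"
  using moves_commute[OF move_props(1) move_props(1), of x y origin] move_props(2) by simp

lemma comm_group_torus: "comm_group torus"
proof (rule comm_groupI)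
  fix x :: 'a
  obtain y where "move x y = origin" using moves_surj[OF move_props(1)] by blast
  then show "\<exists>y\<in>carrier torus. y \<otimes>\<^bsub>torus\<^esub> x = \<one>\<^bsub>torus\<^esub>" using move_commute by auto
qed (auto simp: move_move move_props(2) move_commute simp flip: id_apply intro: move_commute)

lemma move_shift: "s \<in> dirs \<Longrightarrow> move (shift s origin) = shift s"
  by (intro move_eq shift_moves)

lemma inv_torus: "s \<in> dirs \<Longrightarrow> inv\<^bsub>torus\<^esub> (shift s origin) = shift (- s) origin"
  using comm_group_torus
  by (intro group.inv_equality) (auto simp: comm_group_def move_shift neg_dirs)

end

context sharp_walk
begin

lemma torus_structure:
  "\<exists>\<Gamma> m a. weighted_flat_torus \<Gamma> m a w mu d \<and>
     (\<forall>x x'. mu x = mu x') \<and>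
     (\<forall>x x'. \<forall>i\<in>{1..m}. d x (a i \<otimes>\<^bsub>\<Gamma>\<^esub> x) = d x' (a i \<otimes>\<^bsub>\<Gamma>\<^esub> x'))"
proof -
  interpret T: comm_group torus by (rule comm_group_torus)
  obtain B where B: "independent B" "card B = betti1 w mu d" "dirs = B \<union> uminus ` B" "B \<inter> uminus ` B = {}"
    by (rule dirs_basis)
  define m where "m = betti1 w mu d"
  have "finite B" using B(1) by (rule independent_imp_finite)
  then obtain h where h: "bij_betw h {1..m} B"
    using ex_bij_betw_nat_finite_1[of B] B(2) by (auto simp: m_def)
  \<comment> \<open>One generator for each pair \<open>s\<close>, \<open>- s\<close>, of which
    \<open>B\<close> contains exactly one member. Left multiplication by \<open>a i\<close> is then
    \<open>shift (h i)\<close>.\<close>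
  define a where "a i = shift (h i) origin" for i
  have hB: "h i \<in> B" if "i \<in> {1..m}" for i using h that by (auto simp: bij_betw_def)
  have hd: "h i \<in> dirs" "- h i \<in> dirs" if "i \<in> {1..m}" for i using hB[OF that] B(3) by auto
  have ax: "a i \<otimes>\<^bsub>torus\<^esub> x = shift (h i) x" "inv\<^bsub>torus\<^esub> (a i) \<otimes>\<^bsub>torus\<^esub> x = shift (- h i) x"
    if "i \<in> {1..m}" for i x
    using hd[OF that] by (simp_all add: a_def inv_torus move_shift)
  have pow: "\<exists>r\<in>dirs. \<forall>x. a i [^]\<^bsub>torus\<^esub> e \<otimes>\<^bsub>torus\<^esub> x = shift r x"
    if i: "i \<in> {1..m}" and e: "e \<in> {1, -1}" for i and e :: int
  proof -
    consider "a i [^]\<^bsub>torus\<^esub> e = a i" | "a i [^]\<^bsub>torus\<^esub> e = inv\<^bsub>torus\<^esub> (a i)"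
      using e by (auto simp: T.int_pow_1 T.int_pow_neg)
    then show ?thesis using ax[OF i] hd[OF i] by cases metis+
  qed
  have nbr_iff: "nbr x y \<longleftrightarrow>
      (\<exists>i\<in>{1..m}. y = a i \<otimes>\<^bsub>torus\<^esub> x \<or> y = inv\<^bsub>torus\<^esub> (a i) \<otimes>\<^bsub>torus\<^esub> x)" for x y
  proof
    assume "nbr x y"
    then obtain s where s: "s \<in> dirs" "y = shift s x" by (rule nbr_shift)
    obtain b where b: "b \<in> B" "s = b \<or> s = - b" using s(1) B(3) by auto
    obtain i where i: "i \<in> {1..m}" "h i = b" using h b(1) by (auto simp: bij_betw_def)
    then have "y = a i \<otimes>\<^bsub>torus\<^esub> x \<or> y = inv\<^bsub>torus\<^esub> (a i) \<otimes>\<^bsub>torus\<^esub> x"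
      using s(2) b(2) by (simp only: ax) blast
    then show "\<exists>i\<in>{1..m}. y = a i \<otimes>\<^bsub>torus\<^esub> x \<or> y = inv\<^bsub>torus\<^esub> (a i) \<otimes>\<^bsub>torus\<^esub> x"
      using i(1) by blast
  next
    assume "\<exists>i\<in>{1..m}. y = a i \<otimes>\<^bsub>torus\<^esub> x \<or> y = inv\<^bsub>torus\<^esub> (a i) \<otimes>\<^bsub>torus\<^esub> x"
    then show "nbr x y" using ax hd shift_props(1) by metis
  qed
  have gen: "x \<in> generate torus (a ` {1..m})" for x
  proof (induction x rule: nbr_induct[of _ "\<one>\<^bsub>torus\<^esub>"])
    case base show ?case by (rule generate.one)
  next
    case (step x y)
    then obtain i where i: "i \<in> {1..m}" "y = a i \<otimes>\<^bsub>torus\<^esub> x \<or> y = inv\<^bsub>torus\<^esub> (a i) \<otimes>\<^bsub>torus\<^esub> x"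
      using nbr_iff by blast
    then have "a i \<in> generate torus (a ` {1..m})" "inv\<^bsub>torus\<^esub> (a i) \<in> generate torus (a ` {1..m})"
      by (auto intro: generate.incl generate.inv)
    then show ?case using i(2) generate.eng[OF _ step(1)] by metis
  qed
  have distinct: "a i \<noteq> a j \<and> a i \<noteq> inv\<^bsub>torus\<^esub> (a j)" if ij: "i \<in> {1..m}" "j \<in> {1..m}" "i \<noteq> j" for i j
  proof -
    have "h i \<noteq> h j" using inj_on_eq_iff[OF bij_betw_imp_inj_on[OF h] ij(1,2)] ij(3) by simp
    moreover have "h i \<noteq> - h j" using hB[OF ij(1)] imageI[OF hB[OF ij(2)], of uminus] B(4) by auto
    ultimately show ?thesis
      unfolding a_def inv_torus[OF hd(1)[OF ij(2)]]
      using shift_inj[OF hd(1)[OF ij(1)] hd(1)[OF ij(2)], of origin]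
        shift_inj[OF hd(1)[OF ij(1)] hd(2)[OF ij(2)], of origin] by blast
  qed
  have w_neg: "w x (shift (- h i) x) = w x (shift (h i) x)" if "i \<in> {1..m}" for x i
    using shift_symmetric(1)[OF hd(1)[OF that], of x] mu_pos[of x] by (simp add: trans_prob_def)
  have "weighted_flat_torus torus m a w mu d"
    unfolding weighted_flat_torus_def
  proof (intro conjI allI ballI impI)
    show "a i \<noteq> a j" "a i \<noteq> inv\<^bsub>torus\<^esub> (a j)" if "i \<in> {1..m}" "j \<in> {1..m}" "i \<noteq> j" for i j
      using distinct[OF that] by auto
    show "(0 < w x y) = (\<exists>i\<in>{1..m}. y = a i \<otimes>\<^bsub>torus\<^esub> x \<or> y = inv\<^bsub>torus\<^esub> (a i) \<otimes>\<^bsub>torus\<^esub> x)" for x y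
      using nbr_iff[of x y] by (simp only: adj_def)
    show "w x (a i \<otimes>\<^bsub>torus\<^esub> x) * d x (a i \<otimes>\<^bsub>torus\<^esub> x) =
        w x (inv\<^bsub>torus\<^esub> (a i) \<otimes>\<^bsub>torus\<^esub> x) * d x (inv\<^bsub>torus\<^esub> (a i) \<otimes>\<^bsub>torus\<^esub> x)" if "i \<in> {1..m}" for x i
      by (simp only: ax[OF that] w_neg[OF that] shift_symmetric(2)[OF hd(1)[OF that]])
    show "p x (a i [^]\<^bsub>torus\<^esub> e1 \<otimes>\<^bsub>torus\<^esub> x) =
        p (a j [^]\<^bsub>torus\<^esub> e2 \<otimes>\<^bsub>torus\<^esub> x) (a i [^]\<^bsub>torus\<^esub> e1 \<otimes>\<^bsub>torus\<^esub> (a j [^]\<^bsub>torus\<^esub> e2 \<otimes>\<^bsub>torus\<^esub> x))"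
      if "i \<in> {1..m}" "j \<in> {1..m}" "i \<noteq> j" "e1 \<in> {1, -1}" "e2 \<in> {1, -1}" for x i j and e1 e2 :: int
      using pow[OF that(1,4)] p_shift_const by metis
    show "d x (a i \<otimes>\<^bsub>torus\<^esub> x) = d (a j \<otimes>\<^bsub>torus\<^esub> x) (a i \<otimes>\<^bsub>torus\<^esub> (a j \<otimes>\<^bsub>torus\<^esub> x))"
      if "i \<in> {1..m}" "j \<in> {1..m}" "i \<noteq> j" for x i j
      unfolding ax[OF that(1)] ax[OF that(2)] by (rule d_shift_const[OF hd(1)[OF that(1)]])
  qed (use comm_group_torus gen in \<open>auto simp: m_def\<close>)
  moreover have "d x (a i \<otimes>\<^bsub>torus\<^esub> x) = d x' (a i \<otimes>\<^bsub>torus\<^esub> x')" if "i \<in> {1..m}" for x x' i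
    unfolding ax[OF that] by (rule d_shift_const[OF hd(1)[OF that]])
  ultimately show ?thesis using mu_const by blast
qed

end

section \<open>Flat tori and the equivalence\<close>

text \<open>Translation by an element \<open>h\<close> of \<open>S\<close> couples the walks at the
  two ends of an edge and moves all mass by the same distance; commutativity makes it carry one walk
  to the other. The at most \<open>2 * m\<close> elements of \<open>S\<close> bound the
  degree.\<close>

lemma (in markov_graph) flat_torus_sharp_walk:
  assumes torus: "weighted_flat_torus \<Gamma> m a w mu d"
    and mu_const: "\<And>x x'. mu x = mu x'"
    and d_const: "\<And>x x' i. i \<in> {1..m} \<Longrightarrow> d x (a i \<otimes>\<^bsub>\<Gamma>\<^esub> x) = d x' (a i \<otimes>\<^bsub>\<Gamma>\<^esub> x')"
  shows "sharp_walk w mu d"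
proof -
  have "comm_group \<Gamma>" using torus unfolding weighted_flat_torus_def by blast
  then interpret G: comm_group \<Gamma> .
  note T = torus[unfolded weighted_flat_torus_def]
  have "carrier \<Gamma> = UNIV" using T by (elim conjE)
  then have carrier [simp]: "x \<in> carrier \<Gamma>" for x by simp
  have betti: "betti1 w mu d = m" using T by (elim conjE)
  define S where "S = a ` {1..m} \<union> (\<lambda>i. inv\<^bsub>\<Gamma>\<^esub> (a i)) ` {1..m}"
  have "\<forall>x y. w x y > 0 \<longleftrightarrow> (\<exists>i\<in>{1..m}. y = a i \<otimes>\<^bsub>\<Gamma>\<^esub> x \<or> y = inv\<^bsub>\<Gamma>\<^esub> (a i) \<otimes>\<^bsub>\<Gamma>\<^esub> x)"
    using T by (elim conjE)
  then have "nbr x y \<longleftrightarrow> (\<exists>i\<in>{1..m}. y = a i \<otimes>\<^bsub>\<Gamma>\<^esub> x \<or> y = inv\<^bsub>\<Gamma>\<^esub> (a i) \<otimes>\<^bsub>\<Gamma>\<^esub> x)" for x y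
    by (simp only: adj_def)
  then have nbr_iff: "nbr x y \<longleftrightarrow> (\<exists>h\<in>S. y = h \<otimes>\<^bsub>\<Gamma>\<^esub> x)" for x y
    unfolding S_def by (simp only: bex_Un image_iff bex_simps) blast
  have rev: "\<forall>x. \<forall>i\<in>{1..m}. w x (a i \<otimes>\<^bsub>\<Gamma>\<^esub> x) * d x (a i \<otimes>\<^bsub>\<Gamma>\<^esub> x) =
        w x (inv\<^bsub>\<Gamma>\<^esub> (a i) \<otimes>\<^bsub>\<Gamma>\<^esub> x) * d x (inv\<^bsub>\<Gamma>\<^esub> (a i) \<otimes>\<^bsub>\<Gamma>\<^esub> x)"
    using T by (elim conjE)
  have transverse: "\<forall>x. \<forall>i\<in>{1..m}. \<forall>j\<in>{1..m}. i \<noteq> j \<longrightarrow>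
      (\<forall>e1\<in>{1, -1::int}. \<forall>e2\<in>{1, -1::int}. p x (a i [^]\<^bsub>\<Gamma>\<^esub> e1 \<otimes>\<^bsub>\<Gamma>\<^esub> x) =
      p (a j [^]\<^bsub>\<Gamma>\<^esub> e2 \<otimes>\<^bsub>\<Gamma>\<^esub> x) (a i [^]\<^bsub>\<Gamma>\<^esub> e1 \<otimes>\<^bsub>\<Gamma>\<^esub> (a j [^]\<^bsub>\<Gamma>\<^esub> e2 \<otimes>\<^bsub>\<Gamma>\<^esub> x)))"
    using T by (elim conjE)
  have cancel [simp]: "inv\<^bsub>\<Gamma>\<^esub> g \<otimes>\<^bsub>\<Gamma>\<^esub> (g \<otimes>\<^bsub>\<Gamma>\<^esub> x) = x" "g \<otimes>\<^bsub>\<Gamma>\<^esub> (inv\<^bsub>\<Gamma>\<^esub> g \<otimes>\<^bsub>\<Gamma>\<^esub> x) = x" for g x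
    by (simp_all add: G.m_assoc[symmetric])
  have d_inv: "d x (inv\<^bsub>\<Gamma>\<^esub> (a i) \<otimes>\<^bsub>\<Gamma>\<^esub> x) = d x' (a i \<otimes>\<^bsub>\<Gamma>\<^esub> x')" if "i \<in> {1..m}" for x x' i
    using d_const[OF that, of "inv\<^bsub>\<Gamma>\<^esub> (a i) \<otimes>\<^bsub>\<Gamma>\<^esub> x" x'] by (simp add: d_sym)
  have d_S: "d x (h \<otimes>\<^bsub>\<Gamma>\<^esub> x) = d x' (h \<otimes>\<^bsub>\<Gamma>\<^esub> x')" if "h \<in> S" for h x x'
    using that d_const d_inv by (auto simp: S_def) metis
  have w_inv: "w x (inv\<^bsub>\<Gamma>\<^esub> (a i) \<otimes>\<^bsub>\<Gamma>\<^esub> x) = w x (a i \<otimes>\<^bsub>\<Gamma>\<^esub> x)" if i: "i \<in> {1..m}" for x i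
  proof -
    have "nbr x (a i \<otimes>\<^bsub>\<Gamma>\<^esub> x)" using i nbr_iff by (auto simp: S_def)
    then have "d x (a i \<otimes>\<^bsub>\<Gamma>\<^esub> x) \<noteq> 0" using nbr_neq by simp
    then show ?thesis using bspec[OF spec[OF rev] i, of x] unfolding d_inv[OF i, of x x] by simp
  qed
  \<comment> \<open>Along \<open>a i\<close> itself this follows from \<open>w_inv\<close> and the
    symmetry of \<open>w\<close>; along another generator it is the torus condition on
    \<open>p\<close>, in which the constant \<open>mu\<close> cancels.\<close>
  have w_const: "w x (a i \<otimes>\<^bsub>\<Gamma>\<^esub> x) = w z (a i \<otimes>\<^bsub>\<Gamma>\<^esub> z)" if i: "i \<in> {1..m}" for x z i
  proof (induction x rule: nbr_induct[of _ z])
    case (step x y)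
    then obtain j where j: "j \<in> {1..m}" "y = a j \<otimes>\<^bsub>\<Gamma>\<^esub> x \<or> y = inv\<^bsub>\<Gamma>\<^esub> (a j) \<otimes>\<^bsub>\<Gamma>\<^esub> x"
      using nbr_iff by (auto simp: S_def)
    have "w y (a i \<otimes>\<^bsub>\<Gamma>\<^esub> y) = w x (a i \<otimes>\<^bsub>\<Gamma>\<^esub> x)"
    proof (cases "j = i")
      case True
      from j(2) show ?thesis
      proof
        assume y: "y = a j \<otimes>\<^bsub>\<Gamma>\<^esub> x"
        have "w y (a i \<otimes>\<^bsub>\<Gamma>\<^esub> y) = w y x" using w_inv[OF i, of y] y True by simp
        then show ?thesis using y True by (simp add: w_sym)
      next
        assume y: "y = inv\<^bsub>\<Gamma>\<^esub> (a j) \<otimes>\<^bsub>\<Gamma>\<^esub> x"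
        then show ?thesis using w_inv[OF i, of x] True by (simp add: w_sym)
      qed
    next
      case False
      note tr = mp[OF bspec[OF bspec[OF spec[OF transverse, of x] i] j(1)] False[symmetric], THEN bspec, of 1, THEN bspec]
      have "p x (a i \<otimes>\<^bsub>\<Gamma>\<^esub> x) = p y (a i \<otimes>\<^bsub>\<Gamma>\<^esub> y)"
        using j(2) tr[of 1] tr[of "-1"] by (auto simp: G.int_pow_1 G.int_pow_neg)
      then show ?thesis using mu_const[of x y] mu_pos[of x] mu_pos[of y] by (simp add: trans_prob_def)
    qed
    then show ?case using step by simp
  qed simp
  \<comment> \<open>For \<open>h\<close> outside \<open>S\<close> both sides vanish, by cancellation
    in the group.\<close>
  have w_S: "w x (h \<otimes>\<^bsub>\<Gamma>\<^esub> x) = w z (h \<otimes>\<^bsub>\<Gamma>\<^esub> z)" for h x z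
  proof (cases "h \<in> S")
    case True
    then obtain i where i: "i \<in> {1..m}" "h = a i \<or> h = inv\<^bsub>\<Gamma>\<^esub> (a i)" by (auto simp: S_def)
    then show ?thesis using w_const[OF i(1), of x z] w_inv[OF i(1)] by auto
  next
    case False
    have "w x (h \<otimes>\<^bsub>\<Gamma>\<^esub> x) = 0" for x
    proof (rule ccontr)
      assume "w x (h \<otimes>\<^bsub>\<Gamma>\<^esub> x) \<noteq> 0"
      then have "nbr x (h \<otimes>\<^bsub>\<Gamma>\<^esub> x)" using w_nonneg[of x "h \<otimes>\<^bsub>\<Gamma>\<^esub> x"] by (simp add: adj_def)
      then obtain g where "g \<in> S" "h \<otimes>\<^bsub>\<Gamma>\<^esub> x = g \<otimes>\<^bsub>\<Gamma>\<^esub> x" using nbr_iff by blast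
      then show False using False by simp
    qed
    then show ?thesis by simp
  qed
  have p_S: "p x (h \<otimes>\<^bsub>\<Gamma>\<^esub> x) = p z (h \<otimes>\<^bsub>\<Gamma>\<^esub> z)" for h x z
    using w_S[of x h z] mu_const[of x z] by (simp add: trans_prob_def)
  show ?thesis
  proof unfold_locales
    fix x y assume "nbr x y"
    then obtain h where h: "h \<in> S" "y = h \<otimes>\<^bsub>\<Gamma>\<^esub> x" using nbr_iff by blast
    define \<rho> where "\<rho> u v = (if v = h \<otimes>\<^bsub>\<Gamma>\<^esub> u then p x u else 0)" for u v
    have \<rho>': "\<rho> u v = (if u = inv\<^bsub>\<Gamma>\<^esub> h \<otimes>\<^bsub>\<Gamma>\<^esub> v then p x u else 0)" for u v
      unfolding \<rho>_def by auto
    have col: "p x (inv\<^bsub>\<Gamma>\<^esub> h \<otimes>\<^bsub>\<Gamma>\<^esub> v) = p y v" for v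
    proof -
      \<comment> \<open>The element taking \<open>x\<close> to the preimage of \<open>v\<close>
        under translation by \<open>h\<close>; by commutativity it takes \<open>y\<close> to
        \<open>v\<close>.\<close>
      let ?g = "inv\<^bsub>\<Gamma>\<^esub> h \<otimes>\<^bsub>\<Gamma>\<^esub> v \<otimes>\<^bsub>\<Gamma>\<^esub> inv\<^bsub>\<Gamma>\<^esub> x"
      have "?g \<otimes>\<^bsub>\<Gamma>\<^esub> x = inv\<^bsub>\<Gamma>\<^esub> h \<otimes>\<^bsub>\<Gamma>\<^esub> v" by (simp add: G.m_assoc)
      moreover have "?g \<otimes>\<^bsub>\<Gamma>\<^esub> y = v"
        unfolding h(2) using G.m_comm[of h x] G.m_comm[of "inv\<^bsub>\<Gamma>\<^esub> h \<otimes>\<^bsub>\<Gamma>\<^esub> v" h]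
        by (simp add: G.m_assoc)
      ultimately show ?thesis using p_S[of x ?g y] by simp
    qed
    have "coupling (p x) (p y) \<rho>"
      unfolding coupling_def
    proof (intro conjI allI)
      show "\<rho> u v \<ge> 0" for u v by (simp add: \<rho>_def p_nonneg)
      show "(\<Sum>v\<in>UNIV. \<rho> u v) = p x u" for u by (simp add: \<rho>_def)
      show "(\<Sum>u\<in>UNIV. \<rho> u v) = p y v" for v using col[of v] by (simp add: \<rho>')
    qed
    moreover have "transport_cost d \<rho> = (\<Sum>u\<in>UNIV. p x u * d u (h \<otimes>\<^bsub>\<Gamma>\<^esub> u))"
      by (simp add: \<rho>_def if_distrib[of "\<lambda>c. c * _"] cong: if_cong)
    moreover have "d u (h \<otimes>\<^bsub>\<Gamma>\<^esub> u) = d x y" for u unfolding h(2) by (rule d_S[OF h(1)])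
    ultimately show "\<exists>\<rho>. coupling (p x) (p y) \<rho> \<and> transport_cost d \<rho> \<le> d x y"
      using sum_p[of x] by (auto simp flip: sum_distrib_right)
  next
    have "degree_of w x \<le> 2 * m" for x
    proof -
      have "{y. nbr y x} \<subseteq> (\<lambda>h. h \<otimes>\<^bsub>\<Gamma>\<^esub> x) ` S" using nbr_iff nbr_sym by blast
      then have "degree_of w x \<le> card S"
        unfolding degree_of_def by (meson card_image_le card_mono finite order_trans)
      also have "\<dots> \<le> card (a ` {1..m}) + card ((\<lambda>i. inv\<^bsub>\<Gamma>\<^esub> (a i)) ` {1..m})"
        unfolding S_def by (rule card_Un_le)
      also have "\<dots> \<le> m + m"
        using card_image_le[of "{1..m}" a] card_image_le[of "{1..m}" "\<lambda>i. inv\<^bsub>\<Gamma>\<^esub> (a i)"] by simp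
      finally show ?thesis by simp
    qed
    then show "max_degree w \<le> 2 * betti1 w mu d" by (auto simp: max_degree_def betti)
  qed
qed

theorem theorem5p3:
  fixes w :: "'a::finite \<Rightarrow> 'a \<Rightarrow> real"
    and mu :: "'a \<Rightarrow> real"
    and d :: "'a \<Rightarrow> 'a \<Rightarrow> real"
  assumes "weighted_graph w mu"
    and "connected_graph w"
    and "path_distance w d"
    and "\<And>x. (\<Sum>y\<in>UNIV. w x y) = mu x"
  shows "(ollivier_betti_sharp w mu d \<and> bone_idle w mu d \<longleftrightarrow>
          ollivier_betti_sharp w mu d \<and> (\<forall>x y. adj w x y \<longrightarrow> idle_curvature w mu d 1 x y \<ge> 0))
       \<and> (ollivier_betti_sharp w mu d \<and> (\<forall>x y. adj w x y \<longrightarrow> idle_curvature w mu d 1 x y \<ge> 0) \<longleftrightarrow>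
          (\<exists>(\<Gamma> :: 'a monoid) m a.
             weighted_flat_torus \<Gamma> m a w mu d \<and>
             (\<forall>x x'. mu x = mu x') \<and>
             (\<forall>x x'. \<forall>i\<in>{1..m}. d x (a i \<otimes>\<^bsub>\<Gamma>\<^esub> x) = d x' (a i \<otimes>\<^bsub>\<Gamma>\<^esub> x'))))"
    (is "(?sharp \<and> ?idle \<longleftrightarrow> ?sharp \<and> ?nonneg) \<and> (_ \<longleftrightarrow> ?torus)")
proof -
  interpret markov_graph w mu d using assms by unfold_locales
  \<comment> \<open>Each of the three conditions is equivalent to \<open>sharp_walk w mu d\<close>;
    bone-idleness contains \<open>\<kappa>\<^sub>1 \<ge> 0\<close> as the case
    \<open>\<epsilon> = 1\<close>.\<close>
  have walk: "sharp_walk w mu d" if "?sharp" "?nonneg"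
  proof -
    interpret nonneg_walk w mu d using that(2) by (intro nonneg_walkI) blast
    have "real (max_degree w) = real (2 * betti1 w mu d)"
      using that(1) by (simp add: ollivier_betti_sharp_def)
    then have "max_degree w = 2 * betti1 w mu d" by (simp only: of_nat_eq_iff)
    then show ?thesis by unfold_locales simp
  qed
  have "?sharp \<and> ?idle" if "sharp_walk w mu d"
    using sharp_walk.sharp[OF that] sharp_walk.bone_idle[OF that] by blast
  moreover have "?nonneg" if "?idle" using that by (auto simp: bone_idle_def)
  moreover have "?torus" if "sharp_walk w mu d" using sharp_walk.torus_structure[OF that] .
  moreover have "sharp_walk w mu d" if "?torus" using that flat_torus_sharp_walk by blast
  ultimately show ?thesis using walk by blast
qed

end
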